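(* Let $\{G_n\}_{n\in\mathbb N}$ be a sequence of finitely generated groups with generating sets $\{S_n\}_{n\in\mathbb N}$ such that $|S_n|\le k$ for all $n\in\mathbb N$ (for some fixed $k$). Assume that for each $n\in\mathbb N$ there is a short exact sequence $$1\to N_n\to G_n\to Q_n\to1$$ such that: - the sequence $(N_n)_{n\in\mathbb N}$, equipped with the induced metric (from $G_n$), coarsely embeds into a Hilbert space; - the sequence $(Q_n)_{n\in\mathbb N}$, equipped with the word metric associated to the projection $T_n$ of $S_n$ to $Q_n$, coarsely embeds into a Hilbert space. Then the coarse disjoint union $G:=\bigsqcup_{n\in\mathbb N}G_n$ does not measured weakly contain any sequence of measured asymptotic expanders with uniformly bounded geometry.
   Context: $G_n$ carries the word metric associated to $S_n$. A coarse disjoint union of a sequence of metric spaces $(X_n,d_n)$ is the set $X=\bigsqcup_nX_n$ with a metric $d$ restricting to $d_n$ on each $X_n$ and with $d(X_n,X_m)\to\infty$ as $n+m\to\infty$, $n\ne m$. A sequence of metric spaces $\{X_n\}_n$ coarsely embeds into a metric space $Y$ if there are maps $f_n:X_n\to Y$ and non-decreasing unbounded functions $\rho_\pm:[0,\infty)\to[0,\infty)$, independent of $n$, with $\rho_-(d_{X_n}(x,y))\le d_Y(f_n(x),f_n(y))\le\rho_+(d_{X_n}(x,y))$ for all $n$ and $x,y\in X_n$. A sequence of finite measured metric spaces $\{(X_n,d_n,m_n)\}_n$ consists of finite metric spaces $(X_n,d_n)$ with non-trivial finite measures $m_n$ defined on all subsets of $X_n$. It is a sequence of measured asymptotic expanders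 if for every $\alpha\in(0,\frac12]$ there exist $c_\alpha\in(0,1)$ and $R_\alpha>0$ such that for every $n$ and every $A\subseteq X_n$ with $\alpha\, m_n(X_n)\le m_n(A)\le\frac12m_n(X_n)$ one has $m_n(\partial_{R_\alpha}A)>c_\alpha m_n(A)$, where $\partial_RA=\{x\in X_n\setminus A:d_n(x,A)\le R\}$. It has uniformly bounded geometry if $\sup_n\sup_{x\in X_n}|B(x,R)|<\infty$ for all $R>0$, where $B(x,R)$ denotes the closed ball. A metric space $Y$ measured weakly contains $\{(X_n,d_n,m_n)\}_n$ if there are maps $f_n:X_n\to Y$ such that (1) there is a non-decreasing unbounded $\rho_+:[0,\infty)\to[0,\infty)$ with $d_Y(f_n(x),f_n(y))\le\rho_+(d_n(x,y))$ for all $n$ and $x,y\in X_n$; (2) for every $R>0$, $\lim_{n\to\infty}\sup_{x\in X_n}\frac{m_n(f_n^{-1}(B(f_n(x),R)))}{m_n(X_n)}=0$. *)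

theory Defs
  imports "HOL-Analysis.Analysis" "HOL-Algebra.Exact_Sequence"
begin

section \<open>Word metrics and short exact sequences\<close>

text \<open>Generating sets are not assumed symmetric, so words may also use inverses of generators.\<close>

definition word_length :: "('a, 'b) monoid_scheme \<Rightarrow> 'a set \<Rightarrow> 'a \<Rightarrow> nat"
  where "word_length G S g =
    (LEAST l. \<exists>w. length w = l \<and> set w \<subseteq> S \<union> set_inv\<^bsub>G\<^esub> S
               \<and> foldr (\<lambda>x y. x \<otimes>\<^bsub>G\<^esub> y) w \<one>\<^bsub>G\<^esub> = g)"

definition word_metric :: "('a, 'b) monoid_scheme \<Rightarrow> 'a set \<Rightarrow> 'a \<Rightarrow> 'a \<Rightarrow> real"
  where "word_metric G S g h = real (word_length G S (inv\<^bsub>G\<^esub> g \<otimes>\<^bsub>G\<^esub> h))"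

text \<open>
  The library constant \<^const>\<open>short_exact_sequence\<close> forces the three groups to have the same
  element type. The following version, with arrows written from left to right, does not; the two
  agree when the types coincide.
\<close>

definition short_exact ::
    "'n monoid \<Rightarrow> ('n \<Rightarrow> 'a) \<Rightarrow> 'a monoid \<Rightarrow> ('a \<Rightarrow> 'q) \<Rightarrow> 'q monoid \<Rightarrow> bool"
  where "short_exact N \<iota> G \<pi> Q \<longleftrightarrow>
    group N \<and> group G \<and> group Q \<and> \<iota> \<in> mon N G \<and> \<pi> \<in> epi G Q \<and>
    \<iota> ` carrier N = kernel G Q \<pi>"

lemma short_exact_iff_short_exact_sequence:
  "short_exact N \<iota> G \<pi> Q \<longleftrightarrow> short_exact_sequence Q G N \<pi> \<iota>"
  by (auto simp: short_exact_def short_exact_sequence_iff mon_def epi_def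
      group_hom_def group_hom_axioms_def)

section \<open>Sequences of metric spaces\<close>

text \<open>Distances between sets are extended reals, so that the distance to the empty set is
  infinite.\<close>

definition set_gap :: "('a \<Rightarrow> 'a \<Rightarrow> real) \<Rightarrow> 'a set \<Rightarrow> 'a set \<Rightarrow> ereal"
  where "set_gap d A B = (INF a\<in>A. INF b\<in>B. ereal (d a b))"

text \<open>The disjoint union of the \<open>X n\<close> is the set \<open>Sigma UNIV X\<close> of pairs \<open>(n, x)\<close> with
  \<open>x \<in> X n\<close>.\<close>

definition coarse_disjoint_union ::
    "(nat \<Rightarrow> 'a set) \<Rightarrow> (nat \<Rightarrow> 'a \<Rightarrow> 'a \<Rightarrow> real) \<Rightarrow> (nat \<times> 'a \<Rightarrow> nat \<times> 'a \<Rightarrow> real) \<Rightarrow> bool"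
  where "coarse_disjoint_union X dX d \<longleftrightarrow>
    Metric_space (Sigma UNIV X) d \<and>
    (\<forall>n. \<forall>x\<in>X n. \<forall>y\<in>X n. d (n, x) (n, y) = dX n x y) \<and>
    (\<forall>R::real. \<exists>K. \<forall>n m. n \<noteq> m \<longrightarrow> K \<le> n + m \<longrightarrow>
       ereal R \<le> set_gap d ({n} \<times> X n) ({m} \<times> X m))"

definition control_function :: "(real \<Rightarrow> real) \<Rightarrow> bool"
  where "control_function \<rho> \<longleftrightarrow>
    \<rho> ` {0..} \<subseteq> {0..} \<and> mono_on {0..} \<rho> \<and> \<not> bdd_above (\<rho> ` {0..})"

definition coarsely_embeds ::
    "(nat \<Rightarrow> 'x set) \<Rightarrow> (nat \<Rightarrow> 'x \<Rightarrow> 'x \<Rightarrow> real) \<Rightarrow> 'y set \<Rightarrow> ('y \<Rightarrow> 'y \<Rightarrow> real) \<Rightarrow> bool"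
  where "coarsely_embeds X dX Y dY \<longleftrightarrow>
    (\<exists>f \<rho>1 \<rho>2. control_function \<rho>1 \<and> control_function \<rho>2 \<and>
      (\<forall>n. f n \<in> X n \<rightarrow> Y) \<and>
      (\<forall>n. \<forall>x\<in>X n. \<forall>y\<in>X n.
         \<rho>1 (dX n x y) \<le> dY (f n x) (f n y) \<and> dY (f n x) (f n y) \<le> \<rho>2 (dX n x y)))"

section \<open>Measured asymptotic expanders\<close>

definition finite_measured_metric_spaces ::
    "(nat \<Rightarrow> 'x set) \<Rightarrow> (nat \<Rightarrow> 'x \<Rightarrow> 'x \<Rightarrow> real) \<Rightarrow> (nat \<Rightarrow> 'x measure) \<Rightarrow> bool"
  where "finite_measured_metric_spaces X d m \<longleftrightarrow>
    (\<forall>n. finite (X n) \<and> Metric_space (X n) (d n) \<and>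
         space (m n) = X n \<and> sets (m n) = Pow (X n) \<and>
         finite_measure (m n) \<and> emeasure (m n) (X n) \<noteq> 0)"

definition outer_boundary :: "'x set \<Rightarrow> ('x \<Rightarrow> 'x \<Rightarrow> real) \<Rightarrow> real \<Rightarrow> 'x set \<Rightarrow> 'x set"
  where "outer_boundary X d R A = {x \<in> X - A. set_gap d {x} A \<le> ereal R}"

definition measured_asymptotic_expanders ::
    "(nat \<Rightarrow> 'x set) \<Rightarrow> (nat \<Rightarrow> 'x \<Rightarrow> 'x \<Rightarrow> real) \<Rightarrow> (nat \<Rightarrow> 'x measure) \<Rightarrow> bool"
  where "measured_asymptotic_expanders X d m \<longleftrightarrow>
    finite_measured_metric_spaces X d m \<and>
    (\<forall>\<alpha>::real. 0 < \<alpha> \<and> \<alpha> \<le> 1/2 \<longrightarrow>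
      (\<exists>c R::real. 0 < c \<and> c < 1 \<and> 0 < R \<and>
        (\<forall>n. \<forall>A\<subseteq>X n.
           \<alpha> * measure (m n) (X n) \<le> measure (m n) A \<and>
           measure (m n) A \<le> 1/2 * measure (m n) (X n) \<longrightarrow>
           measure (m n) (outer_boundary (X n) (d n) R A) > c * measure (m n) A)))"

definition uniformly_bounded_geometry ::
    "(nat \<Rightarrow> 'x set) \<Rightarrow> (nat \<Rightarrow> 'x \<Rightarrow> 'x \<Rightarrow> real) \<Rightarrow> bool"
  where "uniformly_bounded_geometry X d \<longleftrightarrow>
    (\<forall>R>0. \<exists>K::nat. \<forall>n. \<forall>x\<in>X n.
       finite (Metric_space.mcball (X n) (d n) x R) \<and>
       card (Metric_space.mcball (X n) (d n) x R) \<le> K)"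

definition measured_weakly_contains ::
    "'y set \<Rightarrow> ('y \<Rightarrow> 'y \<Rightarrow> real) \<Rightarrow>
     (nat \<Rightarrow> 'x set) \<Rightarrow> (nat \<Rightarrow> 'x \<Rightarrow> 'x \<Rightarrow> real) \<Rightarrow> (nat \<Rightarrow> 'x measure) \<Rightarrow> bool"
  where "measured_weakly_contains Y dY X d m \<longleftrightarrow>
    (\<exists>f. (\<forall>n. f n \<in> X n \<rightarrow> Y) \<and>
      (\<exists>\<rho>. control_function \<rho> \<and>
        (\<forall>n. \<forall>x\<in>X n. \<forall>y\<in>X n. dY (f n x) (f n y) \<le> \<rho> (d n x y))) \<and>
      (\<forall>R>0. (\<lambda>n. SUP x\<in>X n.
          measure (m n) (f n -` Metric_space.mcball Y dY (f n x) R \<inter> X n) / measure (m n) (X n))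
        \<longlonglongrightarrow> 0))"

end

theory Submission
  imports Defs
begin

text \<open>
  Idea. A controlled map from measured asymptotic expanders to a Hilbert space keeps a fixed
  proportion of the mass in a ball of fixed radius. For real-valued maps this holds because the
  superlevel sets of intermediate measure all have boundary of definite measure, which bounds their
  number in terms of the oscillation. A Hilbert-valued map is composed with a random projection
  \<open>\<Sum>\<^sub>b \<plusminus>\<langle>\<cdot>, b\<rangle>\<close> along a finite orthogonal family: it preserves second moments, and its fourth
  moments are controlled, so by the Paley--Zygmund inequality distant points stay distant with
  probability at least \<open>1/6\<close>. Since a set \<open>Y\<close> of definite proportion has a neighbourhood of almost full
  measure, the same concentration holds for maps defined on \<open>Y\<close> only.

  A definite proportion of \<open>X\<^sub>n\<close> lands in a single group \<open>G\<^sub>i\<close>, as components far out in the disjoint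
  union pull back to sets without boundary. Concentration for the embedding of the quotients, whose
  balls have boundedly many elements, puts a definite proportion into a single coset of \<open>N\<^sub>i\<close>;
  concentration for the embedding of the kernels then puts a definite proportion into a ball of
  bounded radius, contradicting measured weak containment.
\<close>

section \<open>Concentration of real-valued maps\<close>

text \<open>A half-open interval of length \<open>l\<close> holds
  \<open>\<lceil>a + l\<rceil> - \<lceil>a\<rceil>\<close> integers, which is less than
  \<open>l + 1\<close>. This bounds how many equally spaced levels a single point can
  straddle.\<close>

lemma card_nat_interval_le:
  fixes a l :: real
  assumes "0 \<le> l"
  shows "card {j. j < J \<and> a \<le> real j \<and> real j < a + l} \<le> l + 1"
proof -
  have "int ` {j. j < J \<and> a \<le> real j \<and> real j < a + l} \<subseteq> {\<lceil>a\<rceil>..<\<lceil>a + l\<rceil>}"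
    by (auto simp: ceiling_le_iff less_ceiling_iff)
  then have "card (int ` {j. j < J \<and> a \<le> real j \<and> real j < a + l}) \<le> card {\<lceil>a\<rceil>..<\<lceil>a + l\<rceil>}"
    by (intro card_mono) auto
  also have "\<dots> = nat (\<lceil>a + l\<rceil> - \<lceil>a\<rceil>)" by simp
  finally have "card {j. j < J \<and> a \<le> real j \<and> real j < a + l} \<le> nat (\<lceil>a + l\<rceil> - \<lceil>a\<rceil>)"
    by (simp add: card_image)
  moreover have "real (nat (\<lceil>a + l\<rceil> - \<lceil>a\<rceil>)) \<le> l + 1"
    using assms by linarith
  ultimately show ?thesis by linarith
qed

text \<open>The relation \<open>E z a\<close> plays the role of \<open>d z a \<le> R\<close>; only the single scale \<open>\<alpha>\<close> of
  expansion is used at a time.\<close>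

definition expands_at :: "('x \<Rightarrow> real) \<Rightarrow> 'x set \<Rightarrow> ('x \<Rightarrow> 'x \<Rightarrow> bool) \<Rightarrow> real \<Rightarrow> real \<Rightarrow> bool"
  where "expands_at w Z E \<alpha> \<delta> \<longleftrightarrow> (\<forall>A\<subseteq>Z. \<alpha> \<le> sum w A \<longrightarrow> sum w A \<le> 1/2 \<longrightarrow>
    \<delta> \<le> sum w {z \<in> Z - A. \<exists>a\<in>A. E z a})"

text \<open>The bound \<open>osc\<close> varies with the point because a random projection controls
  only its weighted mean. The one-sided form of the conditions lets the result be applied to
  \<open>g\<close> and to \<open>- g\<close>.\<close>

lemma upper_tail_bound:
  fixes g osc w :: "'x \<Rightarrow> real"
  assumes Z: "finite Z" and w: "\<And>z. z \<in> Z \<Longrightarrow> 0 \<le> w z"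
    and ex: "expands_at w Z E \<alpha> \<delta>"
    and osc0: "\<And>z. z \<in> Z \<Longrightarrow> 0 \<le> osc z"
    and osc: "\<And>z a. z \<in> Z \<Longrightarrow> a \<in> Z \<Longrightarrow> E z a \<Longrightarrow> g a \<le> g z + osc z"
    and h: "0 < h" and half: "sum w {z \<in> Z. M < g z} \<le> 1/2"
    and J: "sum w Z + (\<Sum>z\<in>Z. w z * osc z) / h < real J * \<delta>"
  shows "sum w {z \<in> Z. M + real J * h < g z} < \<alpha>"
proof (rule ccontr)
  assume "\<not> ?thesis"
  then have big: "\<alpha> \<le> sum w {z \<in> Z. M + real J * h < g z}" by simp
  \<comment> \<open>Each of the \<open>J\<close> superlevel sets has boundary weight at least \<open>\<delta>\<close>, while a point \<open>z\<close> lies in the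
    boundary of at most \<open>osc z / h + 1\<close> of them.\<close>
  define t where "t j = M + real j * h" for j
  define D where "D j = {z \<in> Z. g z \<le> t j \<and> t j < g z + osc z}" for j
  have D: "\<delta> \<le> sum w (D j)" if "j < J" for j
  proof -
    \<comment> \<open>\<open>A\<close> lies between the tail above \<open>M + real J * h\<close>, of
      weight at least \<open>\<alpha>\<close>, and the part above \<open>M\<close>, of weight at
      most 1/2, so expansion applies to it.\<close>
    define A where "A = {z \<in> Z. t j < g z}"
    have tj: "M \<le> t j" "t j \<le> M + real J * h"
      using that h by (auto simp: t_def intro!: mult_right_mono)
    have "sum w {z \<in> Z. M + real J * h < g z} \<le> sum w A"
      unfolding A_def using Z w tj by (intro sum_mono2) auto
    moreover have "sum w A \<le> sum w {z \<in> Z. M < g z}"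
      unfolding A_def using Z w tj by (intro sum_mono2) auto
    ultimately have "\<delta> \<le> sum w {z \<in> Z - A. \<exists>a\<in>A. E z a}"
      using ex big half unfolding expands_at_def by (elim allE[of _ A]) (auto simp: A_def)
    also have "\<dots> \<le> sum w (D j)"
    proof (intro sum_mono2)
      show "{z \<in> Z - A. \<exists>a\<in>A. E z a} \<subseteq> D j"
        using osc by (fastforce simp: A_def D_def)
    qed (use Z w in \<open>auto simp: D_def\<close>)
    finally show ?thesis .
  qed
  have "real J * \<delta> = (\<Sum>j<J. \<delta>)" by simp
  also have "\<dots> \<le> (\<Sum>j<J. sum w (D j))" using D by (intro sum_mono) auto
  also have "\<dots> = (\<Sum>j<J. \<Sum>z\<in>Z. if z \<in> D j then w z else 0)"
  proof (rule sum.cong[OF refl])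
    fix j show "sum w (D j) = (\<Sum>z\<in>Z. if z \<in> D j then w z else 0)"
      using Z by (simp add: sum.If_cases D_def Int_def)
  qed
  also have "\<dots> = (\<Sum>z\<in>Z. \<Sum>j<J. if z \<in> D j then w z else 0)" by (rule sum.swap)
  also have "\<dots> \<le> (\<Sum>z\<in>Z. w z * (osc z / h + 1))"
  proof (intro sum_mono)
    fix z assume z: "z \<in> Z"
    have "{j. j < J \<and> z \<in> D j}
        \<subseteq> {j. j < J \<and> (g z - M) / h \<le> real j \<and> real j < (g z - M) / h + osc z / h}"
      using h by (auto simp: D_def t_def field_simps)
    then have "card {j. j < J \<and> z \<in> D j}
        \<le> card {j. j < J \<and> (g z - M) / h \<le> real j \<and> real j < (g z - M) / h + osc z / h}"
      by (intro card_mono) auto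
    also have "real \<dots> \<le> osc z / h + 1"
      using osc0[OF z] h by (intro card_nat_interval_le) auto
    finally have c: "real (card {j. j < J \<and> z \<in> D j}) \<le> osc z / h + 1" by simp
    have "(\<Sum>j<J. if z \<in> D j then w z else 0) = w z * real (card {j. j < J \<and> z \<in> D j})"
      by (simp add: sum.If_cases Int_def)
    also have "\<dots> \<le> w z * (osc z / h + 1)" using c w[OF z] by (intro mult_left_mono) auto
    finally show "(\<Sum>j<J. if z \<in> D j then w z else 0) \<le> w z * (osc z / h + 1)" .
  qed
  also have "\<dots> = sum w Z + (\<Sum>z\<in>Z. w z * osc z) / h"
    by (simp add: distrib_left sum.distrib sum_divide_distrib)
  finally show False using J by simp
qed

text \<open>\<open>M\<close> is the least value of \<open>g\<close> whose strict superlevel set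
  weighs at most 1/2. The largest value \<open>v\<close> below \<open>M\<close> fails this test, and
  \<open>{v < g}\<close> is disjoint from \<open>{g < M}\<close>, which leaves less than 1/2 for the
  latter. The bound 1/2 is absolute, as in \<open>expands_at\<close>, even if the total weight is
  below 1.\<close>

lemma weighted_median:
  fixes g w :: "'x \<Rightarrow> real"
  assumes Z: "finite Z" and w: "\<And>z. z \<in> Z \<Longrightarrow> 0 \<le> w z" and le1: "sum w Z \<le> 1"
  obtains M where "sum w {z \<in> Z. M < g z} \<le> 1/2" "sum w {z \<in> Z. g z < M} \<le> 1/2"
proof (cases "Z = {}")
  case True
  then show ?thesis using that[of 0] by simp
next
  case False
  define V where "V = {v \<in> g ` Z. sum w {z \<in> Z. v < g z} \<le> 1/2}"
  have fV: "finite V" using Z by (simp add: V_def)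
  have "Max (g ` Z) \<in> V"
  proof -
    have "{z \<in> Z. Max (g ` Z) < g z} = {}" using Z by (auto simp: not_less)
    then have "sum w {z \<in> Z. Max (g ` Z) < g z} = 0" by (simp only: sum.empty)
    then show ?thesis using Z False by (simp add: V_def)
  qed
  then have ne: "V \<noteq> {}" by auto
  define M where "M = Min V"
  have M: "M \<in> V" using fV ne by (simp add: M_def)
  have "sum w {z \<in> Z. g z < M} \<le> 1/2"
  proof (cases "{z \<in> Z. g z < M} = {}")
    case True
    then show ?thesis by (simp only: sum.empty)
  next
    case L: False
    define v where "v = Max (g ` {z \<in> Z. g z < M})"
    have vin: "v \<in> g ` {z \<in> Z. g z < M}" unfolding v_def using Z L by (intro Max_in) auto
    then have "v < M" "v \<in> g ` Z" by auto
    then have "v \<notin> V" using Min_le[OF fV, of v] unfolding M_def by force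
    then have "sum w {z \<in> Z. v < g z} > 1/2" using \<open>v \<in> g ` Z\<close> by (auto simp: V_def)
    moreover have "sum w {z \<in> Z. g z < M} + sum w {z \<in> Z. v < g z} \<le> sum w Z"
    proof -
      have "g z \<le> v" if "z \<in> Z" "g z < M" for z
        unfolding v_def using Z that by (intro Max_ge) auto
      then have "sum w {z \<in> Z. g z < M} + sum w {z \<in> Z. v < g z}
          = sum w ({z \<in> Z. g z < M} \<union> {z \<in> Z. v < g z})"
        using Z by (intro sum.union_disjoint[symmetric]) force+
      also have "\<dots> \<le> sum w Z" using Z w by (intro sum_mono2) auto
      finally show ?thesis .
    qed
    ultimately show ?thesis using le1 by simp
  qed
  then show ?thesis using that[of M] M by (auto simp: V_def)
qed

text \<open>The tail bound is applied to \<open>g\<close> above the median \<open>M\<close> and to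
  \<open>- g\<close> above \<open>- M\<close>. Off the two tails, of total weight at most
  \<open>2 * \<alpha>\<close>, all values lie within \<open>J * h\<close> of \<open>M\<close>; a
  pair at distance above \<open>2 * (J * h)\<close> therefore has a member in a tail.\<close>

lemma real_concentration:
  fixes g osc w :: "'x \<Rightarrow> real"
  assumes Z: "finite Z" and w: "\<And>z. z \<in> Z \<Longrightarrow> 0 \<le> w z" and le1: "sum w Z \<le> 1"
    and ex: "expands_at w Z E \<alpha> \<delta>"
    and osc0: "\<And>z. z \<in> Z \<Longrightarrow> 0 \<le> osc z"
    and osc: "\<And>z a. z \<in> Z \<Longrightarrow> a \<in> Z \<Longrightarrow> E z a \<Longrightarrow> \<bar>g a - g z\<bar> \<le> osc z"
    and h: "0 < h" and J: "sum w Z + (\<Sum>z\<in>Z. w z * osc z) / h < real J * \<delta>"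
  shows "(\<Sum>x\<in>Z. \<Sum>y\<in>Z. if 2 * (real J * h) < \<bar>g x - g y\<bar> then w x * w y else 0) \<le> 4 * \<alpha>"
proof -
  obtain M where M1: "sum w {z \<in> Z. M < g z} \<le> 1/2" and M2: "sum w {z \<in> Z. g z < M} \<le> 1/2"
    using weighted_median[OF Z w le1] by blast
  define U where "U = {z \<in> Z. M + real J * h < g z}"
  define L where "L = {z \<in> Z. - M + real J * h < - g z}"
  have "sum w U < \<alpha>" unfolding U_def
    by (rule upper_tail_bound[OF Z w ex osc0 _ h M1 J]) (use osc in fastforce)+
  moreover have "sum w L < \<alpha>" unfolding L_def
    by (rule upper_tail_bound[OF Z w ex osc0 _ h _ J]) (use osc M2 in fastforce)+
  ultimately have UL: "sum w U + sum w L \<le> 2 * \<alpha>" by simp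
  define B where "B = U \<union> L"
  have B: "B \<subseteq> Z" "finite B" using Z by (auto simp: B_def U_def L_def)
  have nn: "0 \<le> sum w Z" "0 \<le> sum w B" using w B by (auto intro!: sum_nonneg)
  have "sum w B \<le> sum w U + sum w L"
  proof -
    have "sum w (U \<inter> L) \<ge> 0" using w by (intro sum_nonneg) (auto simp: U_def)
    then show ?thesis unfolding B_def using Z
      by (subst sum_Un) (auto simp: U_def L_def)
  qed
  with UL have B2: "sum w B \<le> 2 * \<alpha>" by simp
  have i: "(\<Sum>z\<in>Z. if z \<in> B then w z else 0) = sum w B"
    using Z B by (simp add: sum.If_cases Int_absorb1)
  have "(\<Sum>x\<in>Z. \<Sum>y\<in>Z. if 2 * (real J * h) < \<bar>g x - g y\<bar> then w x * w y else 0)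
      \<le> (\<Sum>x\<in>Z. \<Sum>y\<in>Z. (if x \<in> B then w x else 0) * w y + w x * (if y \<in> B then w y else 0))"
  proof (intro sum_mono)
    fix x y assume xy: "x \<in> Z" "y \<in> Z"
    have "x \<in> B \<or> y \<in> B" if "2 * (real J * h) < \<bar>g x - g y\<bar>"
      using xy that unfolding B_def U_def L_def by auto
    then show "(if 2 * (real J * h) < \<bar>g x - g y\<bar> then w x * w y else 0)
        \<le> (if x \<in> B then w x else 0) * w y + w x * (if y \<in> B then w y else 0)"
      using w xy by auto
  qed
  also have "\<dots> = 2 * (sum w B * sum w Z)"
    by (simp add: sum.distrib i flip: sum_distrib_left sum_distrib_right)
  also have "\<dots> \<le> 2 * sum w B" using le1 nn by (simp add: mult_left_le)
  also have "\<dots> \<le> 4 * \<alpha>" using B2 by simp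
  finally show ?thesis .
qed

section \<open>Concentration of Hilbert-valued maps\<close>

text \<open>A subset \<open>s\<close> of \<open>B\<close> encodes a choice of signs, so these are
  \<open>2 ^ card B\<close> times the second and fourth moments of a Rademacher sum; the second
  estimate is the Khintchine inequality for exponent 4.\<close>

lemma sum_over_signs_moments:
  fixes a :: "'b \<Rightarrow> real"
  assumes "finite B"
  shows "(\<Sum>s\<in>Pow B. (\<Sum>b\<in>B. if b \<in> s then a b else - a b)\<^sup>2) = 2 ^ card B * (\<Sum>b\<in>B. (a b)\<^sup>2)"
    and "(\<Sum>s\<in>Pow B. (\<Sum>b\<in>B. if b \<in> s then a b else - a b)^4) \<le> 3 * 2 ^ card B * (\<Sum>b\<in>B. (a b)\<^sup>2)\<^sup>2"
  using assms
proof (induction B rule: finite_induct)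
  case empty
  { case 1 then show ?case by simp }
  { case 2 then show ?case by simp }
next
  case (insert c B)
  define U where "U s = (\<Sum>b\<in>B. if b \<in> s then a b else - a b)" for s
  \<comment> \<open>The subsets of \<open>insert c B\<close> come in pairs \<open>s\<close>,
    \<open>insert c s\<close>, which differ only in the sign at \<open>c\<close>. The odd powers of
    \<open>a c\<close> cancel within each pair.\<close>
  have split: "(\<Sum>s\<in>Pow (insert c B). (\<Sum>b\<in>insert c B. if b \<in> s then a b else - a b)^n)
      = (\<Sum>s\<in>Pow B. (U s - a c)^n + (U s + a c)^n)" for n
  proof -
    have dis: "Pow B \<inter> insert c ` Pow B = {}" using insert(2) by auto
    have inj: "inj_on (insert c) (Pow B)" using insert(2) by (auto simp: inj_on_def)
    have e1: "(\<Sum>b\<in>insert c B. if b \<in> s then a b else - a b) = U s - a c" if "s \<in> Pow B" for s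
      using that insert(1,2) by (auto simp: U_def)
    have e2: "(\<Sum>b\<in>insert c B. if b \<in> insert c s then a b else - a b) = U s + a c" if "s \<in> Pow B" for s
    proof -
      have "(\<Sum>b\<in>B. if b \<in> insert c s then a b else - a b) = U s"
        unfolding U_def using insert(2) by (intro sum.cong) auto
      then show ?thesis using insert(1,2) by simp
    qed
    show ?thesis
      unfolding Pow_insert
      by (subst sum.union_disjoint)
        (use insert(1) dis e1 e2 in \<open>auto simp: sum.reindex[OF inj] sum.distrib o_def simp del: sum.insert\<close>)
  qed
  have IH1: "(\<Sum>s\<in>Pow B. (U s)\<^sup>2) = 2 ^ card B * (\<Sum>b\<in>B. (a b)\<^sup>2)"
    and IH2: "(\<Sum>s\<in>Pow B. (U s)^4) \<le> 3 * 2 ^ card B * (\<Sum>b\<in>B. (a b)\<^sup>2)\<^sup>2"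
    using insert.IH by (simp_all add: U_def)
  define u where "u = (\<Sum>b\<in>B. (a b)\<^sup>2)"
  have cP: "real (card (Pow B)) = 2 ^ card B" using insert(1) by (simp add: card_Pow)
  have "(\<Sum>s\<in>Pow B. (U s - a c)\<^sup>2 + (U s + a c)\<^sup>2) = (\<Sum>s\<in>Pow B. 2 * (U s)\<^sup>2 + 2 * (a c)\<^sup>2)"
    by (intro sum.cong) (auto simp: power2_eq_square algebra_simps)
  also have "\<dots> = 2 * (2 ^ card B * u) + 2 ^ card B * (2 * (a c)\<^sup>2)"
    using IH1 cP by (simp add: sum.distrib u_def flip: sum_distrib_left)
  finally have R1: "(\<Sum>s\<in>Pow B. (U s - a c)\<^sup>2 + (U s + a c)\<^sup>2) = 2 ^ Suc (card B) * ((a c)\<^sup>2 + u)"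
    by (simp add: algebra_simps)
  have "(\<Sum>s\<in>Pow B. (U s - a c)^4 + (U s + a c)^4)
      = (\<Sum>s\<in>Pow B. 2 * (U s)^4 + 12 * (a c)\<^sup>2 * (U s)\<^sup>2 + 2 * (a c)^4)"
    by (intro sum.cong) (auto simp: power2_eq_square power4_eq_xxxx algebra_simps)
  also have "\<dots> = 2 * (\<Sum>s\<in>Pow B. (U s)^4) + 12 * (a c)\<^sup>2 * (2 ^ card B * u) + 2 ^ card B * (2 * (a c)^4)"
    using IH1 cP by (simp add: sum.distrib u_def flip: sum_distrib_left)
  \<comment> \<open>Raising the coefficient of \<open>(a c)^4\<close> from 2 to 6 makes the sum a
    multiple of a perfect square.\<close>
  also have "\<dots> \<le> 2 * (3 * 2 ^ card B * u\<^sup>2) + 12 * (a c)\<^sup>2 * (2 ^ card B * u) + 2 ^ card B * (6 * (a c)^4)"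
    using IH2 by (intro add_mono) (auto simp: u_def)
  also have "\<dots> = 3 * 2 ^ Suc (card B) * ((a c)\<^sup>2 + u)\<^sup>2"
    by (simp add: power2_eq_square power4_eq_xxxx algebra_simps)
  finally have R2: "(\<Sum>s\<in>Pow B. (U s - a c)^4 + (U s + a c)^4) \<le> 3 * 2 ^ Suc (card B) * ((a c)\<^sup>2 + u)\<^sup>2" .
  { case 1 show ?case using R1 insert(1,2) split[of 2] by (simp add: u_def) }
  { case 2 show ?case using R2 insert(1,2) split[of 4] by (simp add: u_def) }
qed

text \<open>Averages over the finite set \<open>\<Omega>\<close> play the role of expectations.
  Along an orthogonal family spanning the same space as \<open>F\<close>, Parseval's identity turns
  the moments of the signed coordinate sums into powers of the norm.\<close>

lemma random_sign_projections:
  fixes F :: "'h::real_inner set"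
  assumes "finite F"
  obtains \<Omega> :: "'h set set" and g :: "'h set \<Rightarrow> 'h \<Rightarrow> real"
  where "finite \<Omega>" "\<Omega> \<noteq> {}" "\<And>s u v. g s (u - v) = g s u - g s v"
    "\<And>v. v \<in> span F \<Longrightarrow> (\<Sum>s\<in>\<Omega>. (g s v)\<^sup>2) = card \<Omega> * (norm v)\<^sup>2"
    "\<And>v. v \<in> span F \<Longrightarrow> (\<Sum>s\<in>\<Omega>. (g s v)^4) \<le> 3 * real (card \<Omega>) * ((norm v)\<^sup>2)\<^sup>2"
proof -
  obtain B where B: "finite B" "span B = span F" "pairwise orthogonal B"
    using basis_orthogonal[OF assms] by blast
  \<comment> \<open>\<open>B\<close> may contain the zero vector; its coordinate is 0 because
    division by 0 yields 0.\<close>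
  define a where "a v b = (v \<bullet> b) / norm b" for v b :: 'h
  have parseval: "(\<Sum>b\<in>B. (a v b)\<^sup>2) = (norm v)\<^sup>2" if "v \<in> span F" for v
  proof -
    have "v \<in> range (\<lambda>c. \<Sum>b\<in>B. c b *\<^sub>R b)"
      using that B(2) by (simp flip: span_finite[OF B(1)])
    then obtain c where c: "v = (\<Sum>b\<in>B. c b *\<^sub>R b)" by blast
    have vb: "v \<bullet> b = c b * (norm b)\<^sup>2" if b: "b \<in> B" for b
    proof -
      have "v \<bullet> b = (\<Sum>b'\<in>B. c b' * (b' \<bullet> b))" by (simp add: c inner_sum_left)
      also have "\<dots> = (\<Sum>b'\<in>B. if b' = b then c b * (norm b)\<^sup>2 else 0)"
        using B(3) b by (intro sum.cong) (auto simp: pairwise_def orthogonal_def power2_norm_eq_inner)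
      finally show ?thesis using B(1) b by simp
    qed
    have "(norm v)\<^sup>2 = (\<Sum>b\<in>B. (norm (c b *\<^sub>R b))\<^sup>2)"
      unfolding c by (rule norm_sum_Pythagorean)
        (use B in \<open>auto simp: pairwise_def orthogonal_def\<close>)
    also have "\<dots> = (\<Sum>b\<in>B. (a v b)\<^sup>2)"
      by (intro sum.cong) (auto simp: a_def vb power2_eq_square)
    finally show ?thesis by simp
  qed
  define g where "g s v = (\<Sum>b\<in>B. if b \<in> s then a v b else - a v b)" for s v
  have cP: "real (card (Pow B)) = 2 ^ card B" using B(1) by (simp add: card_Pow)
  show ?thesis
  proof (rule that[of "Pow B" g])
    show "g s (u - v) = g s u - g s v" for s u v
      unfolding g_def sum_subtractf[symmetric]
      by (intro sum.cong) (auto simp: a_def inner_diff_left diff_divide_distrib)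
    fix v assume v: "v \<in> span F"
    show "(\<Sum>s\<in>Pow B. (g s v)\<^sup>2) = card (Pow B) * (norm v)\<^sup>2"
      unfolding g_def cP parseval[OF v, symmetric] by (rule sum_over_signs_moments(1)[OF B(1)])
    show "(\<Sum>s\<in>Pow B. (g s v)^4) \<le> 3 * real (card (Pow B)) * ((norm v)\<^sup>2)\<^sup>2"
      unfolding g_def cP parseval[OF v, symmetric] by (rule sum_over_signs_moments(2)[OF B(1)])
  qed (use B in auto)
qed

text \<open>Averaging the pointwise bound \<open>pt\<close> at \<open>x = (U s)\<^sup>2\<close>
  gives \<open>u \<le> u / 4 + u / 2 + p * (3 * u / 2)\<close>, where \<open>p\<close> is the
  proportion of large values. Hence \<open>p\<close> is at least 1/6.\<close>

lemma paley_zygmund_finite: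
  fixes U :: "'s \<Rightarrow> real" and u :: real
  assumes fin: "finite \<Omega>" and u: "0 < u"
    and U2: "(\<Sum>s\<in>\<Omega>. (U s)\<^sup>2) = card \<Omega> * u"
    and U4: "(\<Sum>s\<in>\<Omega>. (U s)^4) \<le> 3 * real (card \<Omega>) * u\<^sup>2"
  shows "card \<Omega> \<le> 6 * card {s \<in> \<Omega>. u / 4 < (U s)\<^sup>2}"
proof -
  define C where "C = {s \<in> \<Omega>. u / 4 < (U s)\<^sup>2}"
  \<comment> \<open>The factor \<open>1 / (6 * u)\<close> lets the fourth moment contribute only
    \<open>u / 2\<close>; for large \<open>x\<close> the bound comes from
    \<open>(x - 3 * u)\<^sup>2 \<ge> 0\<close>.\<close>
  have pt: "x \<le> u / 4 + x\<^sup>2 / (6 * u) + (if u / 4 < x then 3 * u / 2 else 0)" if "0 \<le> x" for x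
  proof (cases "u / 4 < x")
    case True
    have "0 \<le> (x - 3 * u)\<^sup>2 / (6 * u)" using u by simp
    also have "\<dots> = x\<^sup>2 / (6 * u) + 3 * u / 2 - x"
      using u by (simp add: power2_eq_square field_simps)
    finally show ?thesis using True u by simp
  next
    case False
    have "0 \<le> x\<^sup>2 / (6 * u)" using u by simp
    with False show ?thesis by simp
  qed
  have "card \<Omega> * u = (\<Sum>s\<in>\<Omega>. (U s)\<^sup>2)" using U2 by simp
  also have "\<dots> \<le> (\<Sum>s\<in>\<Omega>. u / 4 + (U s)^4 / (6 * u) + (if s \<in> C then 3 * u / 2 else 0))"
    using pt[of "(U _)\<^sup>2"] by (intro sum_mono) (auto simp: C_def)
  also have "\<dots> = card \<Omega> * (u / 4) + (\<Sum>s\<in>\<Omega>. (U s)^4) / (6 * u) + card C * (3 * u / 2)"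
  proof -
    have "\<Omega> \<inter> C = C" by (auto simp: C_def)
    then show ?thesis using fin by (simp add: sum.distrib sum.If_cases sum_divide_distrib)
  qed
  also have "\<dots> \<le> card \<Omega> * (u / 4) + (3 * real (card \<Omega>) * u\<^sup>2) / (6 * u) + card C * (3 * u / 2)"
    using U4 u by (intro add_mono divide_right_mono) auto
  also have "\<dots> = (card \<Omega> * (3 / 4) + card C * (3 / 2)) * u"
    using u by (simp add: power2_eq_square field_simps)
  finally have "card \<Omega> \<le> card \<Omega> * (3 / 4) + card C * (3 / 2 :: real)" using u by simp
  then show ?thesis unfolding C_def by simp
qed

text \<open>A pair at distance above \<open>4 * J * h\<close>, with
  \<open>h = K * L / \<theta>\<close>, stays at distance above \<open>2 * J * h\<close> under at
  least 1/6 of the projections. Real concentration bounds the weight of such pairs by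
  \<open>4 * \<alpha>\<close> for all but a proportion \<open>\<theta>\<close> of the projections,
  and double counting gives the factor 6.\<close>

lemma hilbert_concentration:
  fixes \<phi> :: "'x \<Rightarrow> 'h::real_inner" and w :: "'x \<Rightarrow> real"
  assumes Z: "finite Z" and w: "\<And>z. z \<in> Z \<Longrightarrow> 0 \<le> w z" and le1: "sum w Z \<le> 1"
    and ex: "expands_at w Z E \<alpha> \<delta>" and \<alpha>: "0 \<le> \<alpha>"
    and K: "\<And>z. z \<in> Z \<Longrightarrow> card {a \<in> Z. E z a} \<le> K" "0 < K"
    and L: "\<And>z a. z \<in> Z \<Longrightarrow> a \<in> Z \<Longrightarrow> E z a \<Longrightarrow> dist (\<phi> a) (\<phi> z) \<le> L" "0 < L"
    and \<theta>: "0 < \<theta>" and J: "2 < real J * \<delta>"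
  shows "(\<Sum>x\<in>Z. \<Sum>y\<in>Z. if 4 * real J * real K * L / \<theta> < dist (\<phi> x) (\<phi> y) then w x * w y else 0)
    \<le> 6 * (4 * \<alpha> + \<theta>)"
proof -
  obtain \<Omega> :: "'h set set" and g where fin: "finite \<Omega>" and ne: "\<Omega> \<noteq> {}"
    and gd: "\<And>s u v. g s (u - v) = g s u - g s v"
    and g2: "\<And>v. v \<in> span (\<phi> ` Z) \<Longrightarrow> (\<Sum>s\<in>\<Omega>. (g s v)\<^sup>2) = card \<Omega> * (norm v)\<^sup>2"
    and g4: "\<And>v. v \<in> span (\<phi> ` Z) \<Longrightarrow> (\<Sum>s\<in>\<Omega>. (g s v)^4) \<le> 3 * real (card \<Omega>) * ((norm v)\<^sup>2)\<^sup>2"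
    using random_sign_projections[of "\<phi> ` Z"] Z by blast
  have sp: "\<phi> x - \<phi> y \<in> span (\<phi> ` Z)" if "x \<in> Z" "y \<in> Z" for x y
    using that by (intro span_diff span_base) auto
  define N where "N = real (card \<Omega>)"
  have N: "0 < N" using fin ne by (simp add: N_def card_gt_0_iff)
  define G where "G s x = g s (\<phi> x)" for s x
  have G: "G s x - G s y = g s (\<phi> x - \<phi> y)" for s x y by (simp add: G_def gd)
  \<comment> \<open>A sum over neighbours instead of a maximum: it dominates each difference, and
    its mean over \<open>s\<close> can be taken term by term.\<close>
  define osc where "osc s z = (\<Sum>a\<in>{a\<in>Z. E z a}. \<bar>G s a - G s z\<bar>)" for s z
  define V where "V s = (\<Sum>z\<in>Z. w z * osc s z)" for s
  \<comment> \<open>The mean of \<open>V s\<close> is at most \<open>K * L\<close>, so by Markov's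
    inequality \<open>V s\<close> exceeds \<open>h\<close> for at most a proportion
    \<open>\<theta>\<close> of the projections.\<close>
  define h where "h = K * L / \<theta>"
  have h: "0 < h" using K L \<theta> by (simp add: h_def)
  have edge: "(\<Sum>s\<in>\<Omega>. \<bar>G s a - G s z\<bar>) \<le> N * L" if "z \<in> Z" "a \<in> Z" "E z a" for z a
  proof -
    \<comment> \<open>The inequality of arithmetic and geometric means passes from the second
      moment, at most \<open>L\<^sup>2\<close>, to the first.\<close>
    have pt: "\<bar>t\<bar> \<le> (t\<^sup>2 / L + L) / 2" for t :: real
    proof -
      have "0 \<le> (\<bar>t\<bar> - L)\<^sup>2 / L" using L by simp
      also have "\<dots> = t\<^sup>2 / L + L - 2 * \<bar>t\<bar>" using L
        by (simp add: power2_diff field_simps) (simp add: power2_eq_square)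
      finally show ?thesis by simp
    qed
    have "(\<Sum>s\<in>\<Omega>. \<bar>G s a - G s z\<bar>) \<le> (\<Sum>s\<in>\<Omega>. ((G s a - G s z)\<^sup>2 / L + L) / 2)"
      by (intro sum_mono pt)
    also have "\<dots> = ((\<Sum>s\<in>\<Omega>. (G s a - G s z)\<^sup>2) / L + N * L) / 2"
      by (simp add: sum.distrib N_def flip: sum_divide_distrib)
    also have "\<dots> = (N * (dist (\<phi> a) (\<phi> z))\<^sup>2 / L + N * L) / 2"
      using that by (simp add: G g2 sp N_def dist_norm)
    also have "\<dots> \<le> (N * L\<^sup>2 / L + N * L) / 2"
      using L that N by (intro divide_right_mono add_mono mult_left_mono power_mono) auto
    also have "\<dots> = N * L" using L by (simp add: power2_eq_square)
    finally show ?thesis .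
  qed
  have "(\<Sum>s\<in>\<Omega>. V s) = (\<Sum>z\<in>Z. w z * (\<Sum>a\<in>{a\<in>Z. E z a}. \<Sum>s\<in>\<Omega>. \<bar>G s a - G s z\<bar>))"
    unfolding V_def osc_def
    by (subst sum.swap) (simp add: sum_distrib_left sum.swap[of _ "{a \<in> Z. E _ a}"])
  also have "\<dots> \<le> (\<Sum>z\<in>Z. w z * (K * (N * L)))"
  proof (intro sum_mono mult_left_mono w)
    fix z assume z: "z \<in> Z"
    have "(\<Sum>a\<in>{a\<in>Z. E z a}. \<Sum>s\<in>\<Omega>. \<bar>G s a - G s z\<bar>) \<le> (\<Sum>a\<in>{a\<in>Z. E z a}. N * L)"
      using edge z by (intro sum_mono) auto
    also have "\<dots> = card {a\<in>Z. E z a} * (N * L)" by simp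
    also have "\<dots> \<le> K * (N * L)" using K(1)[OF z] N L by (intro mult_right_mono) auto
    finally show "(\<Sum>a\<in>{a\<in>Z. E z a}. \<Sum>s\<in>\<Omega>. \<bar>G s a - G s z\<bar>) \<le> K * (N * L)" .
  qed
  also have "\<dots> = sum w Z * (K * (N * L))" by (simp add: sum_distrib_right)
  also have "\<dots> \<le> K * (N * L)" using le1 N L by (intro mult_left_le_one_le sum_nonneg w) auto
  finally have sumV: "(\<Sum>s\<in>\<Omega>. V s) \<le> K * (N * L)" .
  have osc0: "0 \<le> osc s z" for s z by (auto simp: osc_def intro!: sum_nonneg)
  have V0: "0 \<le> V s" for s using w osc0 by (auto simp: V_def intro!: sum_nonneg)
  define Bad where "Bad = {s \<in> \<Omega>. h < V s}"
  have "card Bad * h = (\<Sum>s\<in>Bad. h)" by simp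
  also have "\<dots> \<le> (\<Sum>s\<in>Bad. V s)" by (intro sum_mono) (auto simp: Bad_def)
  also have "\<dots> \<le> (\<Sum>s\<in>\<Omega>. V s)" using fin V0 by (intro sum_mono2) (auto simp: Bad_def)
  also have "\<dots> \<le> (\<theta> * N) * h" using sumV \<theta> by (simp add: h_def mult.commute mult.left_commute)
  finally have bad: "card Bad \<le> \<theta> * N" using h by simp
  define P where "P s = (\<Sum>x\<in>Z. \<Sum>y\<in>Z. if 2 * (real J * h) < \<bar>G s x - G s y\<bar> then w x * w y else 0)" for s
  have P: "P s \<le> 4 * \<alpha> + (if s \<in> Bad then 1 else 0)" if s: "s \<in> \<Omega>" for s
  proof (cases "s \<in> Bad")
    case True
    have "P s \<le> (\<Sum>x\<in>Z. \<Sum>y\<in>Z. w x * w y)" unfolding P_def by (intro sum_mono) (auto simp: w)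
    also have "\<dots> = sum w Z * sum w Z" by (simp add: sum_product)
    also have "\<dots> \<le> 1" using le1 by (intro mult_le_one sum_nonneg w) auto
    finally show ?thesis using True \<alpha> by simp
  next
    case False
    have "P s \<le> 4 * \<alpha>" unfolding P_def
    proof (rule real_concentration[OF Z w le1 ex, where osc = "osc s"])
      show "\<bar>G s a - G s z\<bar> \<le> osc s z" if "z \<in> Z" "a \<in> Z" "E z a" for z a
        unfolding osc_def using Z that by (intro member_le_sum) auto
      \<comment> \<open>The total weight and the mean oscillation in units of \<open>h\<close> are
        each at most 1, which is where \<open>2 < real J * \<delta>\<close> enters.\<close>
      have "V s \<le> h" using False s by (simp add: Bad_def)
      then have "V s / h \<le> 1" using h by simp
      then show "sum w Z + (\<Sum>z\<in>Z. w z * osc s z) / h < real J * \<delta>"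
        using J le1 by (simp add: V_def)
    qed (use osc0 h in auto)
    then show ?thesis using False by simp
  qed
  have far: "N \<le> 6 * card {s \<in> \<Omega>. 2 * (real J * h) < \<bar>G s x - G s y\<bar>}"
    if xy: "x \<in> Z" "y \<in> Z" and D: "4 * real J * real K * L / \<theta> < dist (\<phi> x) (\<phi> y)" for x y
  proof -
    let ?v = "\<phi> x - \<phi> y"
    have D': "2 * (real J * h) < norm ?v / 2"
      using D by (simp add: h_def dist_norm)
    moreover have "0 \<le> real J * h" using h by simp
    ultimately have v: "0 < norm ?v" by linarith
    have "card \<Omega> \<le> 6 * card {s \<in> \<Omega>. (norm ?v)\<^sup>2 / 4 < (G s x - G s y)\<^sup>2}"
      unfolding G by (rule paley_zygmund_finite[OF fin _ g2 g4]) (use v sp xy in auto)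
    also have "\<dots> \<le> 6 * card {s \<in> \<Omega>. 2 * (real J * h) < \<bar>G s x - G s y\<bar>}"
    proof (intro mult_left_mono card_mono)
      show "{s \<in> \<Omega>. (norm ?v)\<^sup>2 / 4 < (G s x - G s y)\<^sup>2}
          \<subseteq> {s \<in> \<Omega>. 2 * (real J * h) < \<bar>G s x - G s y\<bar>}"
      proof safe
        fix s assume "(norm ?v)\<^sup>2 / 4 < (G s x - G s y)\<^sup>2"
        then have "(norm ?v / 2)\<^sup>2 < \<bar>G s x - G s y\<bar>\<^sup>2" by (simp add: power_divide)
        then have "norm ?v / 2 < \<bar>G s x - G s y\<bar>" by (rule power2_less_imp_less) simp
        then show "2 * (real J * h) < \<bar>G s x - G s y\<bar>" using D' by simp
      qed
    qed (use fin in auto)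
    finally show ?thesis by (simp add: N_def flip: of_nat_mult)
  qed
  let ?Q = "\<Sum>x\<in>Z. \<Sum>y\<in>Z. if 4 * real J * real K * L / \<theta> < dist (\<phi> x) (\<phi> y) then w x * w y else 0"
  have "N * ?Q = (\<Sum>x\<in>Z. \<Sum>y\<in>Z. if 4 * real J * real K * L / \<theta> < dist (\<phi> x) (\<phi> y) then w x * w y * N else 0)"
    by (simp add: sum_distrib_left if_distrib mult.commute cong: if_cong)
  also have "\<dots> \<le> (\<Sum>x\<in>Z. \<Sum>y\<in>Z. w x * w y
      * (6 * card {s \<in> \<Omega>. 2 * (real J * h) < \<bar>G s x - G s y\<bar>}))"
    using far w by (intro sum_mono) (auto intro!: mult_left_mono)
  also have "\<dots> = 6 * (\<Sum>x\<in>Z. \<Sum>y\<in>Z. \<Sum>s\<in>\<Omega>. if 2 * (real J * h) < \<bar>G s x - G s y\<bar> then w x * w y else 0)"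
    using fin by (simp add: sum.If_cases sum_distrib_left Int_def mult_ac)
  also have "(\<Sum>x\<in>Z. \<Sum>y\<in>Z. \<Sum>s\<in>\<Omega>. if 2 * (real J * h) < \<bar>G s x - G s y\<bar> then w x * w y else 0)
      = (\<Sum>s\<in>\<Omega>. P s)"
    unfolding P_def by (subst sum.swap[of _ \<Omega> Z]) (intro sum.cong refl sum.swap)
  also have "(\<Sum>s\<in>\<Omega>. P s) \<le> (\<Sum>s\<in>\<Omega>. 4 * \<alpha> + (if s \<in> Bad then 1 else 0))"
    by (intro sum_mono P)
  also have "\<dots> = N * (4 * \<alpha>) + card Bad"
  proof -
    have "\<Omega> \<inter> Bad = Bad" by (auto simp: Bad_def)
    then show ?thesis using fin by (simp add: sum.distrib sum.If_cases N_def)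
  qed
  also have "\<dots> \<le> N * (4 * \<alpha> + \<theta>)" using bad by (simp add: algebra_simps)
  finally have "N * ?Q \<le> N * (6 * (4 * \<alpha> + \<theta>))" by (simp only: mult.left_commute)
  then show ?thesis using N by simp
qed

section \<open>Measured asymptotic expanders\<close>

text \<open>Normalisation to total weight 1 makes the thresholds independent of \<open>n\<close> and
  lets finite sums stand in for measures.\<close>

definition point_weight :: "'x measure \<Rightarrow> 'x \<Rightarrow> real"
  where "point_weight M x = measure M {x} / measure M (space M)"

lemma point_weight_nonneg: "0 \<le> point_weight M x"
  by (simp add: point_weight_def)

lemma sum_point_weight:
  assumes "finite_measured_metric_spaces X d m" and "A \<subseteq> X n"
  shows "sum (point_weight (m n)) A = measure (m n) A / measure (m n) (X n)"
proof -
  have f: "finite (X n)" "space (m n) = X n" "sets (m n) = Pow (X n)" "finite_measure (m n)"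
    using assms(1) by (auto simp: finite_measured_metric_spaces_def)
  interpret finite_measure "m n" by (rule f)
  have "measure (m n) A = (\<Sum>x\<in>A. measure (m n) {x})"
    using f assms(2) by (intro measure_eq_sum_singleton) (auto intro: finite_subset)
  then show ?thesis using f by (simp add: point_weight_def sum_divide_distrib)
qed

lemma sum_point_weight_space:
  assumes "finite_measured_metric_spaces X d m"
  shows "sum (point_weight (m n)) (X n) = 1"
proof -
  have "finite_measure (m n)" "emeasure (m n) (X n) \<noteq> 0"
    using assms by (auto simp: finite_measured_metric_spaces_def)
  then have "measure (m n) (X n) \<noteq> 0"
    by (simp add: finite_measure.emeasure_eq_measure)
  then show ?thesis using sum_point_weight[OF assms, of "X n"] by simp
qed

text \<open>The infimum over a nonempty finite set is attained; for the empty set the gap is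
  infinite and both sides fail.\<close>

lemma set_gap_singleton_le_iff:
  assumes "finite A"
  shows "set_gap d {x} A \<le> ereal R \<longleftrightarrow> (\<exists>a\<in>A. d x a \<le> R)"
proof (cases "A = {}")
  case True
  then show ?thesis by (simp add: set_gap_def top_ereal_def)
next
  case False
  have "set_gap d {x} A = Min ((\<lambda>a. ereal (d x a)) ` A)"
    using assms False by (simp add: set_gap_def cInf_eq_Min)
  then show ?thesis using assms False by (simp add: Min_le_iff)
qed

text \<open>The constant \<open>c\<close> obtained here is the original one times
  \<open>\<alpha>\<close>, so the bound on the boundary is absolute and no longer relative to the
  weight of \<open>A\<close>.\<close>

lemma expanders_point_weight:
  assumes mae: "measured_asymptotic_expanders X d m" and \<alpha>: "0 < \<alpha>" "\<alpha> \<le> 1/2"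
  obtains c R where "0 < c" "0 < R"
    "\<And>n A. A \<subseteq> X n \<Longrightarrow> \<alpha> \<le> sum (point_weight (m n)) A \<Longrightarrow> sum (point_weight (m n)) A \<le> 1/2
      \<Longrightarrow> c < sum (point_weight (m n)) {x \<in> X n - A. \<exists>a\<in>A. d n x a \<le> R}"
proof -
  have fm: "finite_measured_metric_spaces X d m"
    using mae by (simp add: measured_asymptotic_expanders_def)
  obtain c R :: real where cR: "0 < c" "0 < R"
    and ex: "\<And>n A. A \<subseteq> X n \<Longrightarrow> \<alpha> * measure (m n) (X n) \<le> measure (m n) A \<Longrightarrow>
           measure (m n) A \<le> 1/2 * measure (m n) (X n) \<Longrightarrow>
           measure (m n) (outer_boundary (X n) (d n) R A) > c * measure (m n) A"
    using mae \<alpha> unfolding measured_asymptotic_expanders_def by meson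
  show ?thesis
  proof (rule that[of "c * \<alpha>" R])
    fix n A
    assume A: "A \<subseteq> X n" and lo: "\<alpha> \<le> sum (point_weight (m n)) A"
      and hi: "sum (point_weight (m n)) A \<le> 1/2"
    have "finite (X n)" using fm by (simp add: finite_measured_metric_spaces_def)
    with A have fA: "finite A" by (rule finite_subset)
    have "measure (m n) (X n) \<noteq> 0"
      using sum_point_weight_space[OF fm, of n] sum_point_weight[OF fm order_refl, of n] by auto
    then have pos: "0 < measure (m n) (X n)" by (simp add: zero_less_measure_iff)
    have eq: "outer_boundary (X n) (d n) R A = {x \<in> X n - A. \<exists>a\<in>A. d n x a \<le> R}"
      using fA by (simp add: outer_boundary_def set_gap_singleton_le_iff)
    have "c * \<alpha> \<le> c * sum (point_weight (m n)) A" using cR lo by simp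
    also have "\<dots> = (c * measure (m n) A) / measure (m n) (X n)"
      by (simp add: sum_point_weight[OF fm A])
    also have "\<dots> < measure (m n) (outer_boundary (X n) (d n) R A) / measure (m n) (X n)"
      using ex[OF A] lo hi pos
      by (intro divide_strict_right_mono) (simp_all add: sum_point_weight[OF fm A] field_simps)
    also have "\<dots> = sum (point_weight (m n)) {x \<in> X n - A. \<exists>a\<in>A. d n x a \<le> R}"
      unfolding eq by (rule sum_point_weight[OF fm, symmetric]) auto
    finally show "c * \<alpha> < sum (point_weight (m n)) {x \<in> X n - A. \<exists>a\<in>A. d n x a \<le> R}" .
  qed (use cR \<alpha> in auto)
qed

text \<open>As long as the weight stays below \<open>1 - \<epsilon>\<close>, enlarging the
  neighbourhood by \<open>R\<close> gains more than \<open>c\<close>: up to weight 1/2 by expansion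
  of the neighbourhood itself, beyond that by expansion of a complement. After \<open>J\<close>
  steps the total weight 1 would be exceeded.\<close>

lemma neighbourhood_growth:
  fixes w :: "'x \<Rightarrow> real"
  assumes ms: "Metric_space X d" and fin: "finite X"
    and w: "\<And>x. 0 \<le> w x" and w1: "sum w X = 1"
    and ex: "\<And>A. A \<subseteq> X \<Longrightarrow> min \<beta> \<epsilon> \<le> sum w A \<Longrightarrow> sum w A \<le> 1/2
      \<Longrightarrow> c < sum w {x \<in> X - A. \<exists>a\<in>A. d x a \<le> R}"
    and R: "0 < R" and c: "0 < c" and J: "1 \<le> real J * c"
    and Y: "Y \<subseteq> X" "\<beta> \<le> sum w Y"
  shows "1 - \<epsilon> \<le> sum w {x \<in> X. \<exists>y\<in>Y. d x y \<le> real J * R}"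
proof (rule ccontr)
  interpret Metric_space X d by (rule ms)
  define V where "V j = {x \<in> X. \<exists>y\<in>Y. d x y \<le> real j * R}" for j
  have VX: "V j \<subseteq> X" and fV: "finite (V j)" for j using fin by (auto simp: V_def)
  have mono: "V i \<subseteq> V j" if "i \<le> j" for i j
  proof -
    have "real i * R \<le> real j * R" using that R by (intro mult_right_mono) auto
    then show ?thesis unfolding V_def by (auto intro: order_trans)
  qed
  have YV: "Y \<subseteq> V j" for j using Y R by (auto simp: V_def intro!: bexI)
  have step: "a \<in> V (Suc j)" if "x \<in> V j" "a \<in> X" "d x a \<le> R" for x a j
  proof -
    obtain y where y: "y \<in> Y" "d x y \<le> real j * R" and x: "x \<in> X" using \<open>x \<in> V j\<close> by (auto simp: V_def)
    have "d a y \<le> d a x + d x y" using x y Y that by (intro triangle) auto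
    also have "\<dots> \<le> real (Suc j) * R" using y that x by (simp add: commute[of a x] algebra_simps)
    finally show ?thesis using y that by (auto simp: V_def)
  qed
  assume "\<not> ?thesis"
  then have small: "sum w (V J) < 1 - \<epsilon>" by (simp add: V_def)
  have incr: "sum w (V j) + c < sum w (V (Suc j))" if j: "j < J" for j
  proof -
    have b: "c < sum w (V (Suc j) - V j)"
    proof (cases "sum w (V j) \<le> 1/2")
      case True
      have "sum w Y \<le> sum w (V j)" using YV fV w by (intro sum_mono2) auto
      then have "c < sum w {x \<in> X - V j. \<exists>a\<in>V j. d x a \<le> R}"
        using True Y VX by (intro ex) auto
      also have "\<dots> \<le> sum w (V (Suc j) - V j)"
      proof (intro sum_mono2)
        show "{x \<in> X - V j. \<exists>a\<in>V j. d x a \<le> R} \<subseteq> V (Suc j) - V j"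
          using step VX commute by (smt (verit) DiffD1 DiffD2 DiffI in_mono mem_Collect_eq subsetI)
      qed (use fV w in auto)
      finally show ?thesis .
    next
      case False
      \<comment> \<open>The complement of \<open>V (Suc j)\<close> is taken, not that of
        \<open>V j\<close>: its boundary lies in \<open>V (Suc j)\<close> and, as neighbours of
        \<open>V j\<close> are in \<open>V (Suc j)\<close>, avoids \<open>V j\<close>. The weight of
        \<open>B\<close> is above \<open>\<epsilon>\<close> and below 1/2.\<close>
      define B where "B = X - V (Suc j)"
      have BX: "B \<subseteq> X" by (simp add: B_def)
      have wB: "sum w B = 1 - sum w (V (Suc j))"
        using fin VX w1 by (simp add: B_def sum_diff)
      have "sum w (V (Suc j)) \<le> sum w (V J)" using j mono fV w by (intro sum_mono2) auto
      moreover have "sum w (V j) \<le> sum w (V (Suc j))" using mono fV w by (intro sum_mono2) auto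
      ultimately have "c < sum w {x \<in> X - B. \<exists>a\<in>B. d x a \<le> R}"
        using small False BX by (intro ex) (auto simp: wB)
      also have "\<dots> \<le> sum w (V (Suc j) - V j)"
        using step by (intro sum_mono2) (use fV w in \<open>auto simp: B_def\<close>)
      finally show ?thesis .
    qed
    have "sum w (V (Suc j) - V j) = sum w (V (Suc j)) - sum w (V j)"
      using fV mono by (intro sum_diff) auto
    with b show ?thesis by simp
  qed
  have J0: "0 < J" using J by (cases J) auto
  have "j \<le> J \<Longrightarrow> 0 < j \<Longrightarrow> real j * c < sum w (V j)" for j
  proof (induction j)
    case (Suc j)
    have "real j * c \<le> sum w (V j)"
      using Suc by (cases "j = 0") (auto simp: sum_nonneg w)
    then show ?case using incr[of j] Suc by (simp add: algebra_simps)
  qed simp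
  from this[of J] have "1 < sum w (V J)" using J J0 by simp
  also have "sum w (V J) \<le> sum w X" using fin VX w by (intro sum_mono2) auto
  finally show False using w1 by simp
qed

text \<open>\<open>D\<close> is chosen before \<open>n\<close>, \<open>Y\<close> and
  \<open>\<phi>\<close>: it depends on \<open>\<beta>\<close>, \<open>\<sigma>\<close> and the
  expander sequence only. Concentration of pairs yields a good centre by averaging.\<close>

lemma concentration_on_subsets:
  fixes X :: "nat \<Rightarrow> 'x set" and \<sigma> :: "real \<Rightarrow> real" and \<beta> :: real
  assumes mae: "measured_asymptotic_expanders X d m" and ubg: "uniformly_bounded_geometry X d"
    and \<sigma>: "mono_on {0..} \<sigma>" and \<beta>: "0 < \<beta>"
  shows "\<exists>D. \<forall>n Y. \<forall>\<phi> :: 'x \<Rightarrow> 'h::real_inner.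
    Y \<subseteq> X n \<longrightarrow> \<beta> \<le> sum (point_weight (m n)) Y \<longrightarrow>
    (\<forall>x\<in>Y. \<forall>y\<in>Y. dist (\<phi> x) (\<phi> y) \<le> \<sigma> (d n x y)) \<longrightarrow>
    (\<exists>x0\<in>Y. \<beta> / 2 \<le> sum (point_weight (m n)) {y \<in> Y. dist (\<phi> x0) (\<phi> y) \<le> D})"
proof -
  let ?w = "\<lambda>n. point_weight (m n)"
  have fm: "finite_measured_metric_spaces X d m"
    using mae by (simp add: measured_asymptotic_expanders_def)
  have fin: "finite (X n)" and ms: "Metric_space (X n) (d n)" for n
    using fm by (auto simp: finite_measured_metric_spaces_def)
  \<comment> \<open>With \<open>\<theta> = \<alpha>\<close>, far pairs weigh at most
    \<open>6 * (4 * \<alpha> + \<alpha>) = 30 * \<alpha>\<close>. Averaging over a set of weight at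
    least 1/2 gives a point with far weight at most
    \<open>60 * \<alpha> \<le> \<beta> / 2\<close>.\<close>
  define \<alpha> where "\<alpha> = min \<beta> 1 / 120"
  have \<alpha>: "0 < \<alpha>" "\<alpha> \<le> 1/2" "120 * \<alpha> \<le> \<beta>" using \<beta> by (auto simp: \<alpha>_def)
  obtain c R where c: "0 < c" "0 < R"
    and ex: "\<And>n A. A \<subseteq> X n \<Longrightarrow> \<alpha> \<le> sum (?w n) A \<Longrightarrow> sum (?w n) A \<le> 1/2
      \<Longrightarrow> c < sum (?w n) {x \<in> X n - A. \<exists>a\<in>A. d n x a \<le> R}"
    using expanders_point_weight[OF mae \<alpha>(1,2)] by blast
  \<comment> \<open>The bound \<open>c / 2\<close> ensures that deleting the complement of
    \<open>Z\<close> costs at most half the expansion constant; the bound 1/2 leaves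
    \<open>Z\<close> at least half of the weight.\<close>
  define \<epsilon> where "\<epsilon> = min (c / 2) (1/2)"
  have \<epsilon>: "0 < \<epsilon>" "\<epsilon> \<le> 1/2" "\<epsilon> \<le> c / 2" using c by (auto simp: \<epsilon>_def)
  have me: "0 < min \<beta> \<epsilon>" "min \<beta> \<epsilon> \<le> 1/2" using \<beta> \<epsilon> by auto
  obtain c' R' where c': "0 < c'" "0 < R'"
    and ex': "\<And>n A. A \<subseteq> X n \<Longrightarrow> min \<beta> \<epsilon> \<le> sum (?w n) A \<Longrightarrow> sum (?w n) A \<le> 1/2
      \<Longrightarrow> c' < sum (?w n) {x \<in> X n - A. \<exists>a\<in>A. d n x a \<le> R'}"
    using expanders_point_weight[OF mae me] by blast
  obtain J' :: nat where J': "1 / c' < real J'" using reals_Archimedean2 by blast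
  define r where "r = real J' * R'"
  have r0: "0 \<le> r" using c' by (simp add: r_def)
  obtain K0 :: nat where K0: "\<And>n x. x \<in> X n \<Longrightarrow> card (Metric_space.mcball (X n) (d n) x R) \<le> K0"
    using ubg c unfolding uniformly_bounded_geometry_def by meson
  \<comment> \<open>\<open>Suc\<close> here and \<open>max 1\<close> in \<open>L\<close> provide
    positivity. In \<open>R + 2 * r\<close>, each endpoint of an edge of length at most
    \<open>R\<close> is moved by at most \<open>r\<close>.\<close>
  define K where "K = Suc K0"
  define L where "L = max 1 (\<sigma> (R + 2 * r))"
  obtain J :: nat where "4 / c < real J" using reals_Archimedean2 by blast
  then have J: "2 < real J * (c / 2)" using c by (simp add: field_simps)
  define D where "D = 4 * real J * real K * L / \<alpha>"
  show ?thesis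
  proof (rule exI[of _ D], intro allI impI)
    fix n Y and \<phi> :: "'x \<Rightarrow> 'h"
    assume Y: "Y \<subseteq> X n" "\<beta> \<le> sum (?w n) Y"
      and lip: "\<forall>x\<in>Y. \<forall>y\<in>Y. dist (\<phi> x) (\<phi> y) \<le> \<sigma> (d n x y)"
    interpret Metric_space "X n" "d n" by (rule ms)
    define Z where "Z = {x \<in> X n. \<exists>y\<in>Y. d n x y \<le> r}"
    have Z: "Z \<subseteq> X n" "finite Z" using fin by (auto simp: Z_def)
    have YZ: "Y \<subseteq> Z" using Y r0 by (auto simp: Z_def intro!: bexI)
    have wZ: "1 - \<epsilon> \<le> sum (?w n) Z"
      unfolding Z_def r_def
    proof (rule neighbourhood_growth[OF ms fin _ _ ex'])
      show "1 \<le> real J' * c'" using J' c' by (simp add: field_simps)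
    qed (use c' Y sum_point_weight_space[OF fm] in \<open>auto simp: point_weight_nonneg\<close>)
    have wX: "sum (?w n) (X n) = 1" by (rule sum_point_weight_space[OF fm])
    have wZ1: "sum (?w n) Z \<le> 1"
      unfolding wX[of, symmetric] using Z fin by (intro sum_mono2) (auto simp: point_weight_nonneg)
    \<comment> \<open>Moving points by at most \<open>r\<close> retracts almost all of \<open>X n\<close> onto \<open>Y\<close>, so that \<open>\<phi> \<circ> p\<close> is a
      controlled map on the set \<open>Z\<close> of almost full weight, where expansion at scale \<open>\<alpha>\<close> survives.\<close>
    define p where "p z = (if z \<in> Y then z else SOME y. y \<in> Y \<and> d n z y \<le> r)" for z
    have p: "p z \<in> Y \<and> d n z (p z) \<le> r" if "z \<in> Z" for z
    proof (cases "z \<in> Y")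
      case True
      then show ?thesis using Y r0 by (auto simp: p_def)
    next
      case False
      have "\<exists>y. y \<in> Y \<and> d n z y \<le> r" using that by (auto simp: Z_def)
      from someI_ex[OF this] show ?thesis using False by (simp add: p_def)
    qed
    have pY: "p y = y" if "y \<in> Y" for y using that by (simp add: p_def)
    have expZ: "expands_at (?w n) Z (\<lambda>x y. d n x y \<le> R) \<alpha> (c / 2)"
      unfolding expands_at_def
    proof (intro allI impI)
      fix A assume A: "A \<subseteq> Z" "\<alpha> \<le> sum (?w n) A" "sum (?w n) A \<le> 1/2"
      let ?B = "{x \<in> X n - A. \<exists>a\<in>A. d n x a \<le> R}"
      have "c < sum (?w n) ?B" using A Z by (intro ex) auto
      also have "\<dots> \<le> sum (?w n) ({z \<in> Z - A. \<exists>a\<in>A. d n z a \<le> R} \<union> (X n - Z))"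
        using fin Z by (intro sum_mono2) (auto simp: point_weight_nonneg)
      also have "\<dots> = sum (?w n) {z \<in> Z - A. \<exists>a\<in>A. d n z a \<le> R} + sum (?w n) (X n - Z)"
        using fin Z by (intro sum.union_disjoint) auto
      also have "sum (?w n) (X n - Z) = 1 - sum (?w n) Z"
        using fin Z wX by (simp add: sum_diff)
      finally show "c / 2 \<le> sum (?w n) {z \<in> Z - A. \<exists>a\<in>A. d n z a \<le> R}"
        using wZ \<epsilon> by simp
    qed
    let ?far = "\<lambda>x y. D < dist (\<phi> (p x)) (\<phi> (p y))"
    have main: "(\<Sum>x\<in>Z. \<Sum>y\<in>Z. if ?far x y then ?w n x * ?w n y else 0) \<le> 6 * (4 * \<alpha> + \<alpha>)"
      unfolding D_def
    proof (rule hilbert_concentration[OF Z(2) point_weight_nonneg wZ1 expZ])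
      show "card {a \<in> Z. d n z a \<le> R} \<le> K" if "z \<in> Z" for z
      proof -
        have "card {a \<in> Z. d n z a \<le> R} \<le> card (mcball z R)"
          using fin Z that by (intro card_mono) (auto simp: mcball_def)
        also have "\<dots> \<le> K0" using K0 that Z by auto
        finally show ?thesis by (simp add: K_def)
      qed
      show "dist (\<phi> (p a)) (\<phi> (p z)) \<le> L" if "z \<in> Z" "a \<in> Z" "d n z a \<le> R" for z a
      proof -
        have in_X: "z \<in> X n" "a \<in> X n" "p z \<in> X n" "p a \<in> X n"
          using that p Z Y by auto
        have "d n (p a) (p z) \<le> d n (p a) a + d n a (p z)" by (intro triangle in_X)
        also have "d n a (p z) \<le> d n a z + d n z (p z)" by (intro triangle in_X)
        finally have "d n (p a) (p z) \<le> R + 2 * r"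
          using p[of z] p[of a] that by (simp add: commute)
        then have "\<sigma> (d n (p a) (p z)) \<le> \<sigma> (R + 2 * r)"
          using r0 c by (intro mono_onD[OF \<sigma>]) auto
        then show ?thesis using lip p[OF that(1)] p[OF that(2)] by (fastforce simp: L_def)
      qed
    qed (use \<alpha> J in \<open>auto simp: K_def L_def\<close>)
    have "\<exists>x\<in>Z. sum (?w n) {y \<in> Z. ?far x y} \<le> 60 * \<alpha>"
    proof (rule ccontr)
      assume "\<not> ?thesis"
      then have far: "60 * \<alpha> < sum (?w n) {y \<in> Z. ?far x y}" if "x \<in> Z" for x using that by force
      have pos: "1/2 \<le> sum (?w n) Z" using wZ \<epsilon> by simp
      \<comment> \<open>A point of positive weight makes the averaged inequality strict.\<close>
      then obtain x1 where x1: "x1 \<in> Z" "0 < ?w n x1"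
        by (metis less_le_not_le linorder_not_le sum_nonpos half_gt_zero zero_less_one order_less_le_trans)
      have "30 * \<alpha> \<le> sum (?w n) Z * (60 * \<alpha>)"
        using pos \<alpha> by (simp add: field_simps)
      also have "\<dots> = (\<Sum>x\<in>Z. ?w n x * (60 * \<alpha>))" by (rule sum_distrib_right)
      also have "\<dots> < (\<Sum>x\<in>Z. ?w n x * sum (?w n) {y \<in> Z. ?far x y})"
      proof (rule sum_strict_mono_ex1[OF Z(2)])
        show "\<forall>x\<in>Z. ?w n x * (60 * \<alpha>) \<le> ?w n x * sum (?w n) {y \<in> Z. ?far x y}"
          using far by (intro ballI mult_left_mono) (auto simp: point_weight_nonneg less_imp_le)
        show "\<exists>x\<in>Z. ?w n x * (60 * \<alpha>) < ?w n x * sum (?w n) {y \<in> Z. ?far x y}"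
          using far x1 by (intro bexI[of _ x1] mult_strict_left_mono) auto
      qed
      also have "\<dots> = (\<Sum>x\<in>Z. \<Sum>y\<in>Z. if ?far x y then ?w n x * ?w n y else 0)"
        using Z by (simp add: sum_distrib_left sum.If_cases Int_def)
      also have "\<dots> \<le> 30 * \<alpha>" using main by simp
      finally show False by simp
    qed
    then obtain x where x: "x \<in> Z" "sum (?w n) {y \<in> Z. ?far x y} \<le> 60 * \<alpha>" by blast
    have fY: "finite Y" using Y fin finite_subset by blast
    have "sum (?w n) Y = sum (?w n) ({y \<in> Y. dist (\<phi> (p x)) (\<phi> y) \<le> D} \<union> {y \<in> Y. D < dist (\<phi> (p x)) (\<phi> y)})"
      by (intro arg_cong[where f = "sum (?w n)"]) auto
    also have "\<dots> = sum (?w n) {y \<in> Y. dist (\<phi> (p x)) (\<phi> y) \<le> D} + sum (?w n) {y \<in> Y. D < dist (\<phi> (p x)) (\<phi> y)}"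
      using fY by (intro sum.union_disjoint) auto
    also have "sum (?w n) {y \<in> Y. D < dist (\<phi> (p x)) (\<phi> y)} \<le> sum (?w n) {y \<in> Z. ?far x y}"
      using YZ Z pY by (intro sum_mono2) (auto simp: point_weight_nonneg)
    finally have "\<beta> / 2 \<le> sum (?w n) {y \<in> Y. dist (\<phi> (p x)) (\<phi> y) \<le> D}"
      using x Y \<alpha> by simp
    then show "\<exists>x0\<in>Y. \<beta> / 2 \<le> sum (?w n) {y \<in> Y. dist (\<phi> x0) (\<phi> y) \<le> D}"
      using p x by blast
  qed
qed

section \<open>Word metrics\<close>

definition is_word :: "('a, 'b) monoid_scheme \<Rightarrow> 'a set \<Rightarrow> 'a list \<Rightarrow> 'a \<Rightarrow> bool"
  where "is_word G S w g \<longleftrightarrow> set w \<subseteq> S \<union> set_inv\<^bsub>G\<^esub> S \<and>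
    foldr (\<lambda>x y. x \<otimes>\<^bsub>G\<^esub> y) w \<one>\<^bsub>G\<^esub> = g"

lemma word_length_le: "is_word G S w g \<Longrightarrow> word_length G S g \<le> length w"
  unfolding word_length_def is_word_def by (rule Least_le) blast

text \<open>\<open>LEAST\<close> is meaningful only if some word represents \<open>g\<close>, which
  the hypothesis provides.\<close>

lemma word_length_attained:
  assumes "is_word G S w g"
  obtains v where "is_word G S v g" "length v = word_length G S g"
proof -
  have "\<exists>l v. length v = l \<and> set v \<subseteq> S \<union> set_inv\<^bsub>G\<^esub> S \<and> foldr (\<lambda>x y. x \<otimes>\<^bsub>G\<^esub> y) v \<one>\<^bsub>G\<^esub> = g"
    using assms unfolding is_word_def by blast
  from LeastI_ex[OF this] show ?thesis
    using that unfolding word_length_def is_word_def by blast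
qed

lemma word_metric_nonneg: "0 \<le> word_metric G S x y"
  by (simp add: word_metric_def)

context group
begin

lemma set_inv_subset_carrier: "S \<subseteq> carrier G \<Longrightarrow> set_inv S \<subseteq> carrier G"
  by (auto simp: SET_INV_def)

lemma foldr_mult_closed:
  "set w \<subseteq> carrier G \<Longrightarrow> foldr (\<otimes>) w \<one> \<in> carrier G"
  by (induction w) auto

lemma foldr_mult_append:
  "set v \<subseteq> carrier G \<Longrightarrow> set w \<subseteq> carrier G \<Longrightarrow>
    foldr (\<otimes>) (v @ w) \<one> = foldr (\<otimes>) v \<one> \<otimes> foldr (\<otimes>) w \<one>"
  by (induction v) (auto simp: m_assoc foldr_mult_closed simp del: foldr_append)

lemma generate_is_word:
  assumes S: "S \<subseteq> carrier G" and g: "g \<in> generate G S"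
  shows "\<exists>w. is_word G S w g"
  using g
proof (induction rule: generate.induct)
  case one
  show ?case by (intro exI[of _ "[]"]) (simp add: is_word_def)
next
  case (incl h)
  then show ?case using S by (intro exI[of _ "[h]"]) (auto simp: is_word_def)
next
  case (inv h)
  then show ?case using S by (intro exI[of _ "[inv h]"]) (auto simp: is_word_def SET_INV_def)
next
  case (eng h1 h2)
  then obtain v w where v: "is_word G S v h1" and w: "is_word G S w h2" by blast
  have "S \<union> set_inv S \<subseteq> carrier G" using S set_inv_subset_carrier by blast
  then have "set v \<subseteq> carrier G" "set w \<subseteq> carrier G" using v w by (auto simp: is_word_def)
  then have "is_word G S (v @ w) (h1 \<otimes> h2)"
    using v w foldr_mult_append[of v w] by (auto simp: is_word_def simp del: foldr_append)
  then show ?case by blast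
qed

text \<open>Left invariance, by which a coset of the kernel is moved isometrically into the
  kernel.\<close>

lemma word_metric_translate:
  assumes "g \<in> carrier G" "x \<in> carrier G" "y \<in> carrier G"
  shows "word_metric G S (g \<otimes> x) (g \<otimes> y) = word_metric G S x y"
proof -
  have "inv (g \<otimes> x) \<otimes> (g \<otimes> y) = inv x \<otimes> y"
    using assms by (simp add: inv_mult_group m_assoc) (simp add: inv_solve_left m_assoc[symmetric])
  then show ?thesis by (simp add: word_metric_def)
qed

text \<open>The ball is covered by the words of length at most \<open>t\<close> over an alphabet of
  at most \<open>2 * k\<close> letters. The bound involves only \<open>k\<close> and
  \<open>t\<close>, hence is uniform over a sequence of groups.\<close>

lemma word_metric_ball_card:
  assumes S: "S \<subseteq> carrier G" "finite S" "card S \<le> k"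
    and words: "\<And>g. g \<in> carrier G \<Longrightarrow> \<exists>w. is_word G S w g" and q: "q \<in> carrier G"
  shows "finite {p \<in> carrier G. word_metric G S q p \<le> real t}"
    and "card {p \<in> carrier G. word_metric G S q p \<le> real t} \<le> (\<Sum>i\<le>t. (2 * k) ^ i)"
proof -
  let ?A = "S \<union> set_inv S"
  let ?W = "{w. set w \<subseteq> ?A \<and> length w \<le> t}"
  have inv_img: "set_inv S = m_inv G ` S" by (auto simp: SET_INV_def)
  have fA: "finite ?A" using S by (simp add: inv_img)
  have cA: "card ?A \<le> 2 * k"
    using card_Un_le[of S "set_inv S"] card_image_le[OF S(2), of "m_inv G"] S(3) by (simp add: inv_img)
  have fW: "finite ?W" using fA by (rule finite_lists_length_le)
  have sub: "{p \<in> carrier G. word_metric G S q p \<le> real t} \<subseteq> (\<lambda>w. q \<otimes> foldr (\<otimes>) w \<one>) ` ?W"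
  proof safe
    fix p assume p: "p \<in> carrier G" "word_metric G S q p \<le> real t"
    have "inv q \<otimes> p \<in> carrier G" using p q by simp
    then obtain w where "is_word G S w (inv q \<otimes> p)" using words by blast
    then obtain v where v: "is_word G S v (inv q \<otimes> p)" "length v = word_length G S (inv q \<otimes> p)"
      by (rule word_length_attained)
    show "p \<in> (\<lambda>w. q \<otimes> foldr (\<otimes>) w \<one>) ` ?W"
    proof
      show "p = q \<otimes> foldr (\<otimes>) v \<one>"
        using v p q by (simp add: is_word_def m_assoc[symmetric])
      show "v \<in> ?W" using v p by (auto simp: is_word_def word_metric_def)
    qed
  qed
  show "finite {p \<in> carrier G. word_metric G S q p \<le> real t}"
    using sub fW finite_surj by blast
  have "card {p \<in> carrier G. word_metric G S q p \<le> real t} \<le> card ?W"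
    using sub fW by (rule surj_card_le[rotated])
  also have "\<dots> = (\<Sum>i\<le>t. card ?A ^ i)" by (rule card_lists_length_le[OF fA])
  also have "\<dots> \<le> (\<Sum>i\<le>t. (2 * k) ^ i)" using cA by (intro sum_mono power_mono) auto
  finally show "card {p \<in> carrier G. word_metric G S q p \<le> real t} \<le> (\<Sum>i\<le>t. (2 * k) ^ i)" .
qed

end

context group_hom
begin

lemma is_word_image:
  assumes S: "S \<subseteq> carrier G" and w: "is_word G S w g"
  shows "is_word H (h ` S) (map h w) (h g)"
proof -
  have A: "S \<union> set_inv\<^bsub>G\<^esub> S \<subseteq> carrier G" using S G.set_inv_subset_carrier by blast
  have "foldr (\<lambda>x y. x \<otimes>\<^bsub>H\<^esub> y) (map h v) \<one>\<^bsub>H\<^esub> = h (foldr (\<lambda>x y. x \<otimes>\<^bsub>G\<^esub> y) v \<one>\<^bsub>G\<^esub>)"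
    if "set v \<subseteq> carrier G" for v
    using that by (induction v) (auto simp: G.foldr_mult_closed)
  moreover have "h ` (S \<union> set_inv\<^bsub>G\<^esub> S) \<subseteq> h ` S \<union> set_inv\<^bsub>H\<^esub> (h ` S)"
    using S by (force simp: SET_INV_def)
  ultimately show ?thesis
    using w A unfolding is_word_def set_map by (metis image_mono order_trans)
qed

text \<open>A shortest word in \<open>G\<close> is mapped letter by letter to a word of the same
  length in \<open>H\<close>.\<close>

lemma word_metric_image_le:
  assumes S: "S \<subseteq> carrier G" and gen: "generate G S = carrier G"
    and x: "x \<in> carrier G" and y: "y \<in> carrier G"
  shows "word_metric H (h ` S) (h x) (h y) \<le> word_metric G S x y"
proof -
  have "inv\<^bsub>G\<^esub> x \<otimes>\<^bsub>G\<^esub> y \<in> generate G S" using x y gen by simp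
  then obtain w where "is_word G S w (inv\<^bsub>G\<^esub> x \<otimes>\<^bsub>G\<^esub> y)" using G.generate_is_word[OF S] by blast
  then obtain v where v: "is_word G S v (inv\<^bsub>G\<^esub> x \<otimes>\<^bsub>G\<^esub> y)"
      "length v = word_length G S (inv\<^bsub>G\<^esub> x \<otimes>\<^bsub>G\<^esub> y)"
    by (rule word_length_attained)
  have "h (inv\<^bsub>G\<^esub> x \<otimes>\<^bsub>G\<^esub> y) = inv\<^bsub>H\<^esub> h x \<otimes>\<^bsub>H\<^esub> h y" using x y by simp
  then have "is_word H (h ` S) (map h v) (inv\<^bsub>H\<^esub> h x \<otimes>\<^bsub>H\<^esub> h y)"
    using is_word_image[OF S v(1)] by simp
  from word_length_le[OF this] show ?thesis using v by (simp add: word_metric_def)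
qed

end

section \<open>Maps into group extensions\<close>

text \<open>Some \<open>s\<close> has \<open>\<rho> s > D\<close>, and monotonicity keeps every
  \<open>t\<close> with \<open>\<rho> t \<le> D\<close> below it. For a lower control function this
  turns closeness of images into closeness of points.\<close>

lemma control_function_bounded_preimage:
  assumes "control_function \<rho>"
  obtains T :: nat where "\<And>t. 0 \<le> t \<Longrightarrow> \<rho> t \<le> D \<Longrightarrow> t \<le> real T"
proof -
  have "\<not> bdd_above (\<rho> ` {0..})" using assms by (simp add: control_function_def)
  then obtain s where s: "0 \<le> s" "D < \<rho> s" by (auto simp: bdd_above_def not_le)
  obtain T :: nat where T: "s \<le> real T" using real_arch_simple by blast
  show ?thesis
  proof (rule that[of T])
    fix t :: real assume t: "0 \<le> t" "\<rho> t \<le> D"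
    show "t \<le> real T"
    proof (rule ccontr)
      assume "\<not> t \<le> real T"
      then have "\<rho> s \<le> \<rho> t"
        using assms s t T by (intro mono_onD[of "{0..}" \<rho>]) (auto simp: control_function_def)
      then show False using s t by simp
    qed
  qed
qed

lemma control_function_comp_mono:
  assumes "control_function \<rho>" "control_function \<rho>'"
  shows "mono_on {0..} (\<lambda>t. \<rho> (\<rho>' t))"
proof (rule mono_onI)
  fix r s :: real assume "r \<in> {0..}" "s \<in> {0..}" "r \<le> s"
  then have "\<rho>' r \<in> {0..}" "\<rho>' s \<in> {0..}" "\<rho>' r \<le> \<rho>' s"
    using assms(2) by (auto simp: control_function_def mono_on_def image_subset_iff)
  then show "\<rho> (\<rho>' r) \<le> \<rho> (\<rho>' s)"
    using assms(1) by (auto simp: control_function_def mono_on_def)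
qed

lemma weighted_pigeonhole:
  fixes w :: "'x \<Rightarrow> real"
  assumes A: "finite A" and B: "finite B" "card B \<le> C" and h: "h ` A \<subseteq> B"
    and b: "0 < b" "b \<le> sum w A"
  shows "\<exists>q\<in>B. b / C \<le> sum w {x \<in> A. h x = q}"
proof -
  have "A \<noteq> {}" using b by auto
  then have "B \<noteq> {}" using h by auto
  then have cB: "0 < card B" using B by (simp add: card_gt_0_iff)
  show ?thesis
  proof (rule ccontr)
    assume "\<not> ?thesis"
    then have "(\<Sum>q\<in>B. sum w {x \<in> A. h x = q}) < (\<Sum>q\<in>B. b / C)"
      using B(1) \<open>B \<noteq> {}\<close> by (intro sum_strict_mono) (auto simp: not_le)
    moreover have "(\<Sum>q\<in>B. sum w {x \<in> A. h x = q}) = sum w A"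
      by (rule sum.group[OF A B(1) h])
    moreover have "(\<Sum>q\<in>B. b / C) \<le> b"
    proof -
      have "real (card B) * b \<le> real C * b" using B b by (intro mult_right_mono) auto
      then show ?thesis using cB B(2) by (simp add: field_simps)
    qed
    ultimately show False using b by simp
  qed
qed

text \<open>If all components were light, they could be added in order of index until the union
  weighs between 1/4 and 1/2. By then the indices have passed \<open>K\<close>, and every component
  left out is too far away for an \<open>R\<close>-boundary to exist, against expansion.\<close>

lemma dominant_component:
  fixes f :: "nat \<Rightarrow> 'x \<Rightarrow> nat \<times> 'a"
  assumes mae: "measured_asymptotic_expanders X dX m"
    and cdu: "coarse_disjoint_union Y dY d"
    and f: "\<And>n. f n \<in> X n \<rightarrow> Sigma UNIV Y" and \<rho>: "mono_on {0..} \<rho>"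
    and lip: "\<And>n x y. x \<in> X n \<Longrightarrow> y \<in> X n \<Longrightarrow> d (f n x) (f n y) \<le> \<rho> (dX n x y)"
  shows "\<exists>\<beta>>0. \<exists>i. \<forall>n. \<beta> \<le> sum (point_weight (m n)) {x \<in> X n. fst (f n x) = i n}"
proof -
  let ?w = "\<lambda>n. point_weight (m n)"
  have fm: "finite_measured_metric_spaces X dX m"
    using mae by (simp add: measured_asymptotic_expanders_def)
  have fin: "finite (X n)" and ms: "Metric_space (X n) (dX n)" for n
    using fm by (auto simp: finite_measured_metric_spaces_def)
  obtain c R where c: "0 < c" "0 < R"
    and ex: "\<And>n A. A \<subseteq> X n \<Longrightarrow> 1/4 \<le> sum (?w n) A \<Longrightarrow> sum (?w n) A \<le> 1/2
      \<Longrightarrow> c < sum (?w n) {x \<in> X n - A. \<exists>a\<in>A. dX n x a \<le> R}"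
    by (rule expanders_point_weight[OF mae, of "1/4"]) auto
  \<comment> \<open>The extra 1 makes the gap strictly larger than \<open>\<rho> R\<close>, the
    largest distance between images of points at distance at most \<open>R\<close>.\<close>
  obtain K where K: "\<And>i j. i \<noteq> j \<Longrightarrow> K \<le> i + j \<Longrightarrow>
      ereal (\<rho> R + 1) \<le> set_gap d ({i} \<times> Y i) ({j} \<times> Y j)"
    using cdu unfolding coarse_disjoint_union_def by meson
  have isolated: "fst (f n x) = fst (f n a) \<or> fst (f n x) + fst (f n a) < K"
    if x: "x \<in> X n" "a \<in> X n" "dX n x a \<le> R" for n x a
  proof (rule ccontr)
    assume neg: "\<not> ?thesis"
    have "f n x \<in> {fst (f n x)} \<times> Y (fst (f n x))" "f n a \<in> {fst (f n a)} \<times> Y (fst (f n a))"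
      using f[of n] x by (auto simp: Pi_iff mem_Sigma_iff split: prod.splits)
    then have "set_gap d ({fst (f n x)} \<times> Y (fst (f n x))) ({fst (f n a)} \<times> Y (fst (f n a)))
        \<le> ereal (d (f n x) (f n a))"
      unfolding set_gap_def by (meson INF_lower2 order_refl)
    then have "ereal (\<rho> R + 1) \<le> ereal (d (f n x) (f n a))"
      using K neg by (meson linorder_not_le order_trans)
    moreover have "\<rho> (dX n x a) \<le> \<rho> R"
      using x ms[of n] c by (intro mono_onD[OF \<rho>]) (auto simp: Metric_space.nonneg)
    ultimately show False using lip[OF x(1,2)] by simp
  qed
  \<comment> \<open>\<open>K\<close> components of weight below \<open>\<beta>\<close> stay below
    1/4 in total, and adding one component to weight below 1/4 does not exceed 1/2.\<close>
  define \<beta> where "\<beta> = 1 / (4 * real (Suc K))"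
  have \<beta>: "0 < \<beta>" "real K * \<beta> < 1/4" "\<beta> \<le> 1/4" by (auto simp: \<beta>_def field_simps)
  have "\<exists>i. \<beta> \<le> sum (?w n) {x \<in> X n. fst (f n x) = i}" for n
  proof (rule ccontr)
    assume "\<not> ?thesis"
    then have P: "sum (?w n) {x \<in> X n. fst (f n x) = i} < \<beta>" for i by (simp add: not_le)
    define U where "U s = {x \<in> X n. fst (f n x) < s}" for s
    have U_Suc: "sum (?w n) (U (Suc s)) = sum (?w n) (U s) + sum (?w n) {x \<in> X n. fst (f n x) = s}" for s
    proof -
      have "U (Suc s) = U s \<union> {x \<in> X n. fst (f n x) = s}" by (auto simp: U_def)
      then show ?thesis using fin by (auto simp: U_def intro!: sum.union_disjoint)
    qed
    have U_le: "sum (?w n) (U s) \<le> real s * \<beta>" for s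
    proof (induction s)
      case 0
      have "U 0 = {}" by (simp add: U_def)
      then show ?case by simp
    next
      case (Suc s)
      then show ?case using U_Suc[of s] P[of s] by (simp add: algebra_simps)
    qed
    have "U (Suc (Max ((\<lambda>x. fst (f n x)) ` X n))) = X n"
      using fin by (auto simp: U_def less_Suc_eq_le)
    then have ex1: "\<exists>s. 1/4 \<le> sum (?w n) (U s)"
      using sum_point_weight_space[OF fm, of n] by (metis divide_le_eq_1 zero_less_numeral one_le_numeral)
    define s where "s = (LEAST s. 1/4 \<le> sum (?w n) (U s))"
    have s: "1/4 \<le> sum (?w n) (U s)" unfolding s_def using ex1 by (rule LeastI_ex)
    have "K < s"
    proof (rule ccontr)
      assume "\<not> ?thesis"
      then have "real s * \<beta> \<le> real K * \<beta>" using \<beta> by (intro mult_right_mono) auto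
      then show False using U_le[of s] s \<beta>(2) by linarith
    qed
    then obtain t where t: "s = Suc t" by (cases s) auto
    have "\<not> 1/4 \<le> sum (?w n) (U t)" using t unfolding s_def by (intro not_less_Least) linarith
    then have "sum (?w n) (U s) \<le> 1/2" using U_Suc[of t] P[of t] \<beta> t by simp
    then have "c < sum (?w n) {x \<in> X n - U s. \<exists>a\<in>U s. dX n x a \<le> R}"
      using s by (intro ex) (auto simp: U_def)
    \<comment> \<open>A point outside \<open>U s\<close> has index at least \<open>s > K\<close>, so
      \<open>isolated\<close> would force its neighbour in \<open>U s\<close> to have the same
      index.\<close>
    also have "{x \<in> X n - U s. \<exists>a\<in>U s. dX n x a \<le> R} = {}"
      using isolated[of _ n] \<open>K < s\<close> by (fastforce simp: U_def)
    finally show False using c by simp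
  qed
  then have "\<exists>i. \<forall>n. \<beta> \<le> sum (?w n) {x \<in> X n. fst (f n x) = i n}" by metis
  then show ?thesis using \<beta> by blast
qed

theorem proposition7p3:
  fixes G :: "nat \<Rightarrow> 'a monoid" and S :: "nat \<Rightarrow> 'a set" and k :: nat
    and N :: "nat \<Rightarrow> 'n monoid" and \<iota> :: "nat \<Rightarrow> 'n \<Rightarrow> 'a"
    and Q :: "nat \<Rightarrow> 'q monoid" and \<pi> :: "nat \<Rightarrow> 'a \<Rightarrow> 'q"
    and d :: "nat \<times> 'a \<Rightarrow> nat \<times> 'a \<Rightarrow> real"
  assumes "\<And>n. group (G n)"
    and "\<And>n. S n \<subseteq> carrier (G n)"
    and "\<And>n. generate (G n) (S n) = carrier (G n)"
    and "\<And>n. finite (S n) \<and> card (S n) \<le> k"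
    and "\<And>n. short_exact (N n) (\<iota> n) (G n) (\<pi> n) (Q n)"
    and "coarsely_embeds (\<lambda>n. carrier (N n))
           (\<lambda>n x y. word_metric (G n) (S n) (\<iota> n x) (\<iota> n y))
           (UNIV :: 'h1 :: {real_inner, complete_space} set) dist"
    and "coarsely_embeds (\<lambda>n. carrier (Q n))
           (\<lambda>n. word_metric (Q n) (\<pi> n ` S n))
           (UNIV :: 'h2 :: {real_inner, complete_space} set) dist"
    and "coarse_disjoint_union (\<lambda>n. carrier (G n)) (\<lambda>n. word_metric (G n) (S n)) d"
  shows "\<not> (\<exists>(X :: nat \<Rightarrow> 'x set) dX m.
            measured_asymptotic_expanders X dX m \<and>
            uniformly_bounded_geometry X dX \<and>
            measured_weakly_contains (SIGMA n:UNIV. carrier (G n)) d X dX m)"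
proof
  assume "\<exists>(X :: nat \<Rightarrow> 'x set) dX m.
            measured_asymptotic_expanders X dX m \<and>
            uniformly_bounded_geometry X dX \<and>
            measured_weakly_contains (SIGMA n:UNIV. carrier (G n)) d X dX m"
  then obtain X :: "nat \<Rightarrow> 'x set" and dX m where mae: "measured_asymptotic_expanders X dX m"
    and ubg: "uniformly_bounded_geometry X dX"
    and mwc: "measured_weakly_contains (SIGMA n:UNIV. carrier (G n)) d X dX m" by blast
  let ?w = "\<lambda>n. point_weight (m n)"
  have fm: "finite_measured_metric_spaces X dX m"
    using mae by (simp add: measured_asymptotic_expanders_def)
  have fin: "finite (X n)" for n
    using fm by (auto simp: finite_measured_metric_spaces_def)
  obtain f \<rho> where f: "\<And>n. f n \<in> X n \<rightarrow> (SIGMA n:UNIV. carrier (G n))"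
    and \<rho>: "control_function \<rho>"
    and lip: "\<And>n x y. x \<in> X n \<Longrightarrow> y \<in> X n \<Longrightarrow> d (f n x) (f n y) \<le> \<rho> (dX n x y)"
    and thin: "\<And>R. R > 0 \<Longrightarrow> (\<lambda>n. SUP x\<in>X n.
          measure (m n) (f n -` Metric_space.mcball (SIGMA n:UNIV. carrier (G n)) d (f n x) R \<inter> X n)
          / measure (m n) (X n)) \<longlonglongrightarrow> 0"
    using mwc unfolding measured_weakly_contains_def by blast
  obtain FQ :: "nat \<Rightarrow> 'q \<Rightarrow> 'h2" and \<rho>1 \<rho>2 where \<rho>1: "control_function \<rho>1" and \<rho>2: "control_function \<rho>2"
    and FQ: "\<And>n x y. x \<in> carrier (Q n) \<Longrightarrow> y \<in> carrier (Q n) \<Longrightarrow>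
         \<rho>1 (word_metric (Q n) (\<pi> n ` S n) x y) \<le> dist (FQ n x) (FQ n y) \<and>
         dist (FQ n x) (FQ n y) \<le> \<rho>2 (word_metric (Q n) (\<pi> n ` S n) x y)"
    using assms(7) unfolding coarsely_embeds_def by blast
  obtain FN :: "nat \<Rightarrow> 'n \<Rightarrow> 'h1" and \<rho>3 \<rho>4 where \<rho>3: "control_function \<rho>3" and \<rho>4: "control_function \<rho>4"
    and FN: "\<And>n x y. x \<in> carrier (N n) \<Longrightarrow> y \<in> carrier (N n) \<Longrightarrow>
         \<rho>3 (word_metric (G n) (S n) (\<iota> n x) (\<iota> n y)) \<le> dist (FN n x) (FN n y) \<and>
         dist (FN n x) (FN n y) \<le> \<rho>4 (word_metric (G n) (S n) (\<iota> n x) (\<iota> n y))"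
    using assms(6) unfolding coarsely_embeds_def by blast
  have gh: "group_hom (G n) (Q n) (\<pi> n)" and ker: "\<iota> n ` carrier (N n) = kernel (G n) (Q n) (\<pi> n)"
    and epi: "\<pi> n ` carrier (G n) = carrier (Q n)" for n
    using assms(5)[of n] by (auto simp: short_exact_def epi_def group_hom_def group_hom_axioms_def)
  have dG: "d (n, x) (n, y) = word_metric (G n) (S n) x y"
    if "x \<in> carrier (G n)" "y \<in> carrier (G n)" for n x y
    using assms(8) that by (simp add: coarse_disjoint_union_def)
  have msd: "Metric_space (SIGMA n:UNIV. carrier (G n)) d"
    using assms(8) by (simp add: coarse_disjoint_union_def)

  \<comment> \<open>Restriction to a single group\<close>
  have \<rho>m: "mono_on {0..} \<rho>" using \<rho> by (simp add: control_function_def)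
  obtain \<beta> i where \<beta>: "0 < \<beta>"
    and Yw: "\<And>n. \<beta> \<le> sum (?w n) {x \<in> X n. fst (f n x) = i n}"
    using dominant_component[OF mae assms(8) f \<rho>m lip] by blast
  define Y where "Y n = {x \<in> X n. fst (f n x) = i n}" for n
  define g where "g n x = snd (f n x)" for n x
  have gG: "g n x \<in> carrier (G (i n))" and fg: "f n x = (i n, g n x)" if "x \<in> Y n" for n x
    using that f[of n] by (auto simp: Y_def g_def Pi_iff mem_Sigma_iff split: prod.splits)
  have YX: "Y n \<subseteq> X n" for n by (auto simp: Y_def)
  have lipG: "word_metric (G (i n)) (S (i n)) (g n x) (g n y) \<le> \<rho> (dX n x y)"
    if "x \<in> Y n" "y \<in> Y n" for n x y
    using lip[of x n y] that YX by (auto simp: fg dG gG)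
  have ctrl: "\<rho>' t \<le> \<rho>' (\<rho> s)" if "control_function \<rho>'" "0 \<le> t" "t \<le> \<rho> s" for \<rho>' t s
    using that by (intro mono_onD[of "{0..}" \<rho>']) (auto simp: control_function_def)

  \<comment> \<open>Concentration in the quotients: a single coset of the kernel\<close>
  let ?\<phi> = "\<lambda>n x. FQ (i n) (\<pi> (i n) (g n x))"
  have piQ: "\<pi> (i n) (g n x) \<in> carrier (Q (i n))" if "x \<in> Y n" for n x
    using gG[OF that] epi by blast
  have lipQ: "dist (?\<phi> n x) (?\<phi> n y) \<le> \<rho>2 (\<rho> (dX n x y))" if xy: "x \<in> Y n" "y \<in> Y n" for n x y
  proof -
    have "word_metric (Q (i n)) (\<pi> (i n) ` S (i n)) (\<pi> (i n) (g n x)) (\<pi> (i n) (g n y)) \<le> \<rho> (dX n x y)"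
      using group_hom.word_metric_image_le[OF gh assms(2,3) gG gG, OF xy] lipG[OF xy] by (rule order_trans)
    then have "\<rho>2 (word_metric (Q (i n)) (\<pi> (i n) ` S (i n)) (\<pi> (i n) (g n x)) (\<pi> (i n) (g n y)))
        \<le> \<rho>2 (\<rho> (dX n x y))"
      by (rule ctrl[OF \<rho>2 word_metric_nonneg])
    then show ?thesis using conjunct2[OF FQ[OF piQ piQ, OF xy]] by linarith
  qed
  obtain D where D: "\<forall>n Y. \<forall>\<phi> :: 'x \<Rightarrow> 'h2. Y \<subseteq> X n \<longrightarrow> \<beta> \<le> sum (?w n) Y \<longrightarrow>
    (\<forall>x\<in>Y. \<forall>y\<in>Y. dist (\<phi> x) (\<phi> y) \<le> \<rho>2 (\<rho> (dX n x y))) \<longrightarrow>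
    (\<exists>x0\<in>Y. \<beta> / 2 \<le> sum (?w n) {y \<in> Y. dist (\<phi> x0) (\<phi> y) \<le> D})"
    using concentration_on_subsets[OF mae ubg control_function_comp_mono[OF \<rho>2 \<rho>] \<beta>, where 'h = 'h2]
    by (rule exE)
  obtain T :: nat where T: "\<And>t. 0 \<le> t \<Longrightarrow> \<rho>1 t \<le> D \<Longrightarrow> t \<le> real T"
    using control_function_bounded_preimage[OF \<rho>1] by blast
  define C where "C = (\<Sum>i\<le>T. (2 * k) ^ i)"
  \<comment> \<open>The summand at 0 is 1, so \<open>C\<close> is positive even for
    \<open>k = 0\<close>.\<close>
  have "1 \<le> C" unfolding C_def using member_le_sum[of 0 "{..T}" "\<lambda>i. (2 * k) ^ i"] by simp
  then have C0: "0 < real C" by simp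
  \<comment> \<open>Points whose images lie within \<open>D\<close> in the Hilbert space project
    into a word ball of radius \<open>T\<close>, which has at most \<open>C\<close> elements; one of
    them carries a share \<open>1 / C\<close> of the weight.\<close>
  have fibre: "\<exists>q. \<beta> / 2 / C \<le> sum (?w n) {x \<in> Y n. \<pi> (i n) (g n x) = q}" for n
  proof -
    obtain x0 where x0: "x0 \<in> Y n" "\<beta> / 2 \<le> sum (?w n) {y \<in> Y n. dist (?\<phi> n x0) (?\<phi> n y) \<le> D}"
      using D[THEN spec[of _ n], THEN spec[of _ "Y n"], THEN spec[of _ "?\<phi> n"]] YX[of n] Yw[of n, folded Y_def] lipQ[of _ n]
      by auto
    let ?A = "{y \<in> Y n. dist (?\<phi> n x0) (?\<phi> n y) \<le> D}"
    let ?B = "{p \<in> carrier (Q (i n)). word_metric (Q (i n)) (\<pi> (i n) ` S (i n)) (\<pi> (i n) (g n x0)) p \<le> real T}"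
    interpret group_hom "G (i n)" "Q (i n)" "\<pi> (i n)" by (rule gh)
    have S: "\<pi> (i n) ` S (i n) \<subseteq> carrier (Q (i n))" "finite (\<pi> (i n) ` S (i n))"
      "card (\<pi> (i n) ` S (i n)) \<le> k"
      using assms(2,4)[of "i n"] card_image_le[of "S (i n)" "\<pi> (i n)"] by auto
    have words: "\<exists>w. is_word (Q (i n)) (\<pi> (i n) ` S (i n)) w q" if "q \<in> carrier (Q (i n))" for q
    proof -
      obtain h where h: "h \<in> carrier (G (i n))" "q = \<pi> (i n) h"
        using \<open>q \<in> carrier (Q (i n))\<close> unfolding epi[of "i n", symmetric] by (rule imageE)
      have "h \<in> generate (G (i n)) (S (i n))" using h(1) by (simp add: assms(3))
      from G.generate_is_word[OF assms(2) this]
      obtain w where "is_word (G (i n)) (S (i n)) w h" by (rule exE)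
      from is_word_image[OF assms(2) this] show ?thesis unfolding h(2) by (rule exI)
    qed
    note ball = H.word_metric_ball_card[OF S words piQ[OF x0(1)], of T]
    have "\<exists>q\<in>?B. \<beta> / 2 / C \<le> sum (?w n) {x \<in> ?A. \<pi> (i n) (g n x) = q}"
    proof (rule weighted_pigeonhole[OF _ ball(1)])
      show "finite ?A" using finite_subset[OF YX fin] by simp
      show "card ?B \<le> C" using ball(2) by (simp add: C_def)
      show "(\<lambda>x. \<pi> (i n) (g n x)) ` ?A \<subseteq> ?B"
      proof safe
        fix y assume y: "y \<in> Y n" "dist (?\<phi> n x0) (?\<phi> n y) \<le> D"
        show "\<pi> (i n) (g n y) \<in> carrier (Q (i n))" by (rule piQ[OF y(1)])
        show "word_metric (Q (i n)) (\<pi> (i n) ` S (i n)) (\<pi> (i n) (g n x0)) (\<pi> (i n) (g n y)) \<le> real T"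
          using FQ[OF piQ[OF x0(1)] piQ[OF y(1)]] y(2) by (intro T word_metric_nonneg) auto
      qed
      show "0 < \<beta> / 2" using \<beta> by simp
      show "\<beta> / 2 \<le> sum (?w n) ?A" by (rule x0(2))
    qed
    then obtain q where "\<beta> / 2 / C \<le> sum (?w n) {x \<in> ?A. \<pi> (i n) (g n x) = q}" by (rule bexE)
    also have "\<dots> \<le> sum (?w n) {x \<in> Y n. \<pi> (i n) (g n x) = q}"
      using finite_subset[OF YX fin] by (intro sum_mono2) (auto simp: point_weight_nonneg)
    finally show ?thesis by (rule exI)
  qed

  \<comment> \<open>Concentration in the kernels: a ball of bounded radius\<close>
  define \<gamma> where "\<gamma> = \<beta> / 2 / C"
  have \<gamma>: "0 < \<gamma>" using \<beta> C0 by (simp add: \<gamma>_def)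
  obtain q where q: "\<And>n. \<gamma> \<le> sum (?w n) {x \<in> Y n. \<pi> (i n) (g n x) = q n}"
    using fibre unfolding \<gamma>_def by metis
  define Y' where "Y' n = {x \<in> Y n. \<pi> (i n) (g n x) = q n}" for n
  have Y'Y: "Y' n \<subseteq> Y n" and Y'X: "Y' n \<subseteq> X n" for n using YX by (auto simp: Y'_def)
  have Y'w: "\<gamma> \<le> sum (?w n) (Y' n)" for n using q by (simp add: Y'_def)
  \<comment> \<open>A base point: left translation by the inverse of \<open>g n (b n)\<close>
    carries the coset over \<open>q n\<close> into the kernel, where \<open>h\<close> takes
    preimages under \<open>\<iota>\<close>.\<close>
  define b where "b n = (SOME x. x \<in> Y' n)" for n
  have b: "b n \<in> Y' n" for n
  proof -
    have "Y' n \<noteq> {}" using Y'w[of n] \<gamma> by auto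
    then show ?thesis by (simp add: b_def some_in_eq)
  qed
  define h where "h n x = inv_into (carrier (N (i n))) (\<iota> (i n))
    (inv\<^bsub>G (i n)\<^esub> g n (b n) \<otimes>\<^bsub>G (i n)\<^esub> g n x)" for n x
  have hN: "h n x \<in> carrier (N (i n))"
    and h: "\<iota> (i n) (h n x) = inv\<^bsub>G (i n)\<^esub> g n (b n) \<otimes>\<^bsub>G (i n)\<^esub> g n x" if x: "x \<in> Y' n" for n x
  proof -
    interpret group_hom "G (i n)" "Q (i n)" "\<pi> (i n)" by (rule gh)
    have "g n (b n) \<in> carrier (G (i n))" "g n x \<in> carrier (G (i n))"
      "\<pi> (i n) (g n (b n)) = q n" "\<pi> (i n) (g n x) = q n"
      using b[of n] x gG Y'Y by (auto simp: Y'_def)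
    then have "inv\<^bsub>G (i n)\<^esub> g n (b n) \<otimes>\<^bsub>G (i n)\<^esub> g n x \<in> \<iota> (i n) ` carrier (N (i n))"
      unfolding ker by (auto simp: kernel_def)
        (metis H.l_inv hom_closed)
    then show "h n x \<in> carrier (N (i n))"
      "\<iota> (i n) (h n x) = inv\<^bsub>G (i n)\<^esub> g n (b n) \<otimes>\<^bsub>G (i n)\<^esub> g n x"
      by (simp_all add: h_def inv_into_into f_inv_into_f)
  qed
  have wh: "word_metric (G (i n)) (S (i n)) (\<iota> (i n) (h n x)) (\<iota> (i n) (h n y))
      = word_metric (G (i n)) (S (i n)) (g n x) (g n y)" if "x \<in> Y' n" "y \<in> Y' n" for n x y
    using that b[of n] gG Y'Y assms(1)
    by (simp add: h group.word_metric_translate group.inv_closed subset_iff)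
  let ?\<psi> = "\<lambda>n x. FN (i n) (h n x)"
  have lipN: "dist (?\<psi> n x) (?\<psi> n y) \<le> \<rho>4 (\<rho> (dX n x y))" if xy: "x \<in> Y' n" "y \<in> Y' n" for n x y
  proof -
    have "\<rho>4 (word_metric (G (i n)) (S (i n)) (g n x) (g n y)) \<le> \<rho>4 (\<rho> (dX n x y))"
      by (rule ctrl[OF \<rho>4 word_metric_nonneg lipG]) (use Y'Y xy in auto)
    then show ?thesis using FN[OF hN hN, OF xy] by (simp add: wh xy)
  qed
  obtain D' where D': "\<forall>n Y. \<forall>\<phi> :: 'x \<Rightarrow> 'h1. Y \<subseteq> X n \<longrightarrow> \<gamma> \<le> sum (?w n) Y \<longrightarrow>
    (\<forall>x\<in>Y. \<forall>y\<in>Y. dist (\<phi> x) (\<phi> y) \<le> \<rho>4 (\<rho> (dX n x y))) \<longrightarrow>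
    (\<exists>x0\<in>Y. \<gamma> / 2 \<le> sum (?w n) {y \<in> Y. dist (\<phi> x0) (\<phi> y) \<le> D'})"
    using concentration_on_subsets[OF mae ubg control_function_comp_mono[OF \<rho>4 \<rho>] \<gamma>, where 'h = 'h1]
    by (rule exE)
  obtain T' :: nat where T': "\<And>t. 0 \<le> t \<Longrightarrow> \<rho>3 t \<le> D' \<Longrightarrow> t \<le> real T'"
    using control_function_bounded_preimage[OF \<rho>3] by blast

  \<comment> \<open>Contradiction with measured weak containment\<close>
  let ?R = "real T' + 1"
  let ?M = "\<lambda>n x. measure (m n) (f n -` Metric_space.mcball (SIGMA n:UNIV. carrier (G n)) d (f n x) ?R \<inter> X n)
          / measure (m n) (X n)"
  have lower: "\<gamma> / 2 \<le> (SUP x\<in>X n. ?M n x)" for n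
  proof -
    obtain x0 where x0: "x0 \<in> Y' n" "\<gamma> / 2 \<le> sum (?w n) {y \<in> Y' n. dist (?\<psi> n x0) (?\<psi> n y) \<le> D'}"
      using D'[THEN spec[of _ n], THEN spec[of _ "Y' n"], THEN spec[of _ "?\<psi> n"]] Y'X[of n] Y'w[of n] lipN[of _ n]
      by auto
    note x0(2)
    also have "sum (?w n) {y \<in> Y' n. dist (?\<psi> n x0) (?\<psi> n y) \<le> D'}
        \<le> sum (?w n) (f n -` Metric_space.mcball (SIGMA n:UNIV. carrier (G n)) d (f n x0) ?R \<inter> X n)"
    proof (intro sum_mono2 subsetI)
      fix y assume "y \<in> {y \<in> Y' n. dist (?\<psi> n x0) (?\<psi> n y) \<le> D'}"
      then have y: "y \<in> Y' n" "dist (?\<psi> n x0) (?\<psi> n y) \<le> D'" by auto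
      have "word_metric (G (i n)) (S (i n)) (g n x0) (g n y) \<le> real T'"
        using FN[OF hN hN, OF x0(1) y(1)] y x0 by (intro T' word_metric_nonneg) (auto simp: wh)
      then have "d (f n x0) (f n y) \<le> ?R"
        using y x0 Y'Y by (simp add: fg dG gG subset_iff)
      then show "y \<in> f n -` Metric_space.mcball (SIGMA n:UNIV. carrier (G n)) d (f n x0) ?R \<inter> X n"
        using y x0 Y'X f[of n] by (auto simp: Metric_space.in_mcball[OF msd] Pi_iff)
    qed (use fin in \<open>auto simp: point_weight_nonneg\<close>)
    also have "\<dots> = ?M n x0" by (rule sum_point_weight[OF fm]) auto
    also have "\<dots> \<le> (SUP x\<in>X n. ?M n x)"
      using fin x0 Y'X by (intro cSUP_upper) auto
    finally show ?thesis .
  qed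
  \<comment> \<open>The added 1 keeps the radius positive when \<open>T' = 0\<close>. Neither the
    radius nor \<open>\<gamma>\<close> depends on \<open>n\<close>, so the bound
    \<open>lower\<close> passes to the limit.\<close>
  have "(\<lambda>n. SUP x\<in>X n. ?M n x) \<longlonglongrightarrow> 0" by (rule thin) simp
  then have "\<gamma> / 2 \<le> 0" by (rule LIMSEQ_le_const) (use lower in blast)
  then show False using \<gamma> by simp
qed

end
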